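(* Let $0<s\leq 1$. There exist a sequence of sets $A_j\subset\left\{\frac{0}{2^j},\frac{1}{2^j},\dots,\frac{2^j-1}{2^j}\right\}$, $j=1,2,\dots$, such that the sets $\bigcup_{a\in A_j}[a,a+2^{-j}]$ are decreasing in $j$, and a probability measure $\mu$ whose support is $$E:=\bigcap_{j=1}^\infty\bigcup_{a\in A_j}[a,a+2^{-j}],$$ such that $\dim_{\mathcal H}(\operatorname{supp}\mu)=\dim_{\mathcal H}E=s$; for every $\epsilon>0$ there is $C_\epsilon$ with $|\widehat{\mu}(\xi)|\leq C_\epsilon|\xi|^{-s/2+\epsilon}$ for all $|\xi|\geq 1$; and there exist $x_0\in\operatorname{supp}\mu$ and $c>0$ with $$\mu(B(x_0,r))\geq c\,r^{s/2}\quad\text{for all }0<r\leq 1.$$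
   Context: $\widehat{\mu}(\xi)=\int e^{-2\pi i x\xi}\,d\mu(x)$; $\dim_{\mathcal H}$ is Hausdorff dimension; $B(x,r)$ is the interval of radius $r$ centered at $x$. *)

theory Defs
  imports "HOL-Probability.Probability"
begin

definition dyadic_grid :: "nat \<Rightarrow> real set" where
  "dyadic_grid j = (\<lambda>k. real k / 2 ^ j) ` {..<2 ^ j}"

definition dyadic_level :: "(nat \<Rightarrow> real set) \<Rightarrow> nat \<Rightarrow> real set" where
  "dyadic_level A j = (\<Union>a\<in>A j. {a .. a + 1 / 2 ^ j})"

(* The index j starts at 1; the value A 0 is irrelevant. *)
definition dyadic_limit :: "(nat \<Rightarrow> real set) \<Rightarrow> real set" where
  "dyadic_limit A = (\<Inter>j\<in>{1..}. dyadic_level A j)"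

definition measure_support :: "'a::topological_space measure \<Rightarrow> 'a set" where
  "measure_support M = {x. \<forall>U. open U \<longrightarrow> x \<in> U \<longrightarrow> emeasure M U > 0}"

(* char M t integrates exp(i t x), so the exp(-2 pi i x xi) normalization is t = -2 pi xi. *)
definition fourier_measure :: "real measure \<Rightarrow> real \<Rightarrow> complex" where
  "fourier_measure M \<xi> = char M (- (2 * pi * \<xi>))"

(* diam(U)^d, with the usual conventions that the empty set contributes 0 and that
   diam(U)^0 = 1 for nonempty U (powr alone would give 0 powr 0 = 0). *)
definition diam_powr :: "real \<Rightarrow> 'a::metric_space set \<Rightarrow> ennreal" where
  "diam_powr d U = (if U = {} then 0 else if d = 0 then 1 else ennreal (diameter U powr d))"

(* Boundedness is required because the library's diameter is real-valued and has no
   meaning on unbounded sets. Finite covers are included, since U n may be empty. *)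
definition hausdorff_premeasure :: "real \<Rightarrow> real \<Rightarrow> 'a::metric_space set \<Rightarrow> ennreal" where
  "hausdorff_premeasure d \<delta> E =
     Inf {(\<Sum>n. diam_powr d (U n)) | U :: nat \<Rightarrow> 'a set.
            E \<subseteq> (\<Union>n. U n) \<and> (\<forall>n. bounded (U n) \<and> diameter (U n) \<le> \<delta>)}"

definition hausdorff_measure :: "real \<Rightarrow> 'a::metric_space set \<Rightarrow> ennreal" where
  "hausdorff_measure d E = (SUP \<delta>\<in>{0<..}. hausdorff_premeasure d \<delta> E)"

definition hausdorff_dim :: "'a::metric_space set \<Rightarrow> ennreal" where
  "hausdorff_dim E = Inf (ennreal ` {d. 0 \<le> d \<and> hausdorff_measure d E = 0})"

end

theory Submission
  imports Defs
begin

text \<open>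
  Let \<open>\<nu>\<close> be a Salem measure of dimension \<open>s\<close> on \<open>[0, 1]\<close>: its balls of radius \<open>r\<close> have mass
  \<open>O(r\<^sup>s)\<close>, it lives on about \<open>2\<^sup>s\<^sup>j\<close> dyadic intervals of level \<open>j\<close>, and its Fourier transform decays
  like \<open>\<bar>t\<bar>\<^sup>-\<^sup>a\<close> for every \<open>a < s / 2\<close>. The measure \<open>\<mu>\<close> is the mixture of the dilates of \<open>\<nu>\<close> by
  \<open>2\<^sup>-\<^sup>n\<close> with weights proportional to \<open>2\<^sup>-\<^sup>n\<^sup>s\<^sup>/\<^sup>2\<close>. Dilation by \<open>2\<^sup>-\<^sup>n\<close> costs a factor
  \<open>2\<^sup>n\<^sup>a\<close> in the Fourier bound, which the weights absorb, while the weights of the dilates inside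
  \<open>B(0, r)\<close> add up to about \<open>r\<^sup>s\<^sup>/\<^sup>2\<close>. Every closed subset of \<open>[0, 1]\<close> is the limit of the dyadic
  intervals meeting it, which gives the sets \<open>A\<^sub>j\<close>.

  For \<open>\<nu>\<close>, one passes from level \<open>j\<close> to level \<open>j + 1\<close> either by keeping both halves of all
  intervals or by keeping one half of each, such that \<open>2\<^sup>m\<close> intervals with \<open>m = \<lfloor>s j\<rfloor>\<close> remain.
  A choice of halves changes the Fourier transform by a trigonometric sum with coefficients
  \<open>\<plusminus>2\<^sup>-\<^sup>m\<close>, and for suitable signs this sum is \<open>O(j 2\<^sup>-\<^sup>m\<^sup>/\<^sup>2)\<close> uniformly in the frequency.
\<close>

section \<open>Random signs\<close>

lemma cosh_le_exp_square:
  fixes y :: real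
  assumes "\<bar>y\<bar> \<le> 1"
  shows "cosh y \<le> exp (y\<^sup>2)"
proof -
  have nonneg: "cosh z \<le> exp (z\<^sup>2)" if z: "0 \<le> z" "z \<le> 1" for z :: real
  proof -
    have "exp z \<le> 1 + z + z\<^sup>2"
      using exp_bound z by auto
    moreover have "exp (- z) \<le> 1 - z + z\<^sup>2"
    proof -
      \<comment> \<open>The bound on \<open>exp (- z)\<close> amounts to
        \<open>1 <= exp z * (1 - z + z^2)\<close>. Replacing \<open>exp z\<close> by its lower bound
        \<open>1 + z\<close> turns the right side into \<open>1 + z ^ 3\<close>.\<close>
      have "1 + z ^ 3 = (1 + z) * (1 - z + z\<^sup>2)"
        by (simp add: power2_eq_square power3_eq_cube algebra_simps)
      moreover have "0 \<le> 1 - z + z\<^sup>2"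
        using z by simp
      ultimately have "1 + z ^ 3 \<le> exp z * (1 - z + z\<^sup>2)"
        using exp_ge_add_one_self[of z] by (metis mult_right_mono)
      moreover have "0 \<le> z ^ 3"
        using z by simp
      ultimately have "1 \<le> exp z * (1 - z + z\<^sup>2)"
        by linarith
      then show ?thesis
        by (simp add: exp_minus field_simps)
    qed
    ultimately have "cosh z \<le> 1 + z\<^sup>2"
      by (simp add: cosh_def)
    also have "\<dots> \<le> exp (z\<^sup>2)"
      by (rule exp_ge_add_one_self)
    finally show ?thesis .
  qed
  show ?thesis
  proof (cases "0 \<le> y")
    case True
    then show ?thesis using nonneg[of y] assms by auto
  next
    case False
    then show ?thesis using nonneg[of "- y"] assms by auto
  qed
qed

text \<open>The potential is the exponential moment of Hoeffding's inequality. Averaging over the sign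
  of a new term multiplies it by at most \<open>exp (l\<^sup>2)\<close>, so one of the two signs does.\<close>

lemma exists_signs_cosh_sum:
  fixes c :: "'p \<Rightarrow> nat \<Rightarrow> real"
  assumes "\<And>p i. p \<in> P \<Longrightarrow> \<bar>c p i\<bar> \<le> 1" and l: "0 \<le> l" "l \<le> 1"
  shows "\<exists>e. (\<forall>i. e i \<in> {-1, 1}) \<and>
    (\<Sum>p\<in>P. cosh (l * (\<Sum>i<n. e i * c p i))) \<le> card P * exp (l\<^sup>2 * n)"
proof (induction n)
  case 0
  show ?case by (intro exI[of _ "\<lambda>_. 1"]) simp
next
  case (Suc n)
  then obtain e where e: "\<And>i. e i \<in> {-1, 1}"
    and le: "(\<Sum>p\<in>P. cosh (l * (\<Sum>i<n. e i * c p i))) \<le> card P * exp (l\<^sup>2 * n)"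
    by blast
  define S where "S = (\<lambda>p. l * (\<Sum>i<n. e i * c p i))"
  define F where "F = (\<lambda>d. \<Sum>p\<in>P. cosh (S p + d * (l * c p n)))"
  have "F 1 + F (-1) = (\<Sum>p\<in>P. 2 * cosh (S p) * cosh (l * c p n))"
    unfolding F_def by (simp add: sum.distrib[symmetric] cosh_add cosh_diff mult.assoc)
  also have "\<dots> \<le> (\<Sum>p\<in>P. 2 * cosh (S p) * exp (l\<^sup>2))"
  proof (intro sum_mono mult_left_mono)
    fix p assume p: "p \<in> P"
    have abs: "\<bar>l * c p n\<bar> \<le> l"
      using assms(1)[OF p, of n] l by (simp add: abs_mult mult_left_le)
    then have "cosh (l * c p n) \<le> exp ((l * c p n)\<^sup>2)"
      using l by (intro cosh_le_exp_square) simp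
    also have "\<dots> \<le> exp (l\<^sup>2)"
      using abs l by (simp add: abs_le_square_iff[symmetric])
    finally show "cosh (l * c p n) \<le> exp (l\<^sup>2)" .
  qed simp
  also have "\<dots> = 2 * exp (l\<^sup>2) * (\<Sum>p\<in>P. cosh (S p))"
    by (simp add: sum_distrib_left sum_distrib_right mult_ac)
  also have "\<dots> \<le> 2 * exp (l\<^sup>2) * (card P * exp (l\<^sup>2 * n))"
    using le unfolding S_def by (intro mult_left_mono) auto
  finally have "F 1 + F (-1) \<le> 2 * (card P * exp (l\<^sup>2 * Suc n))"
    by (simp add: exp_add algebra_simps)
  then obtain d where d: "d \<in> {-1, 1}" "F d \<le> card P * exp (l\<^sup>2 * Suc n)"
    by (cases "F 1 \<le> F (-1)") force+
  have "(\<Sum>i<Suc n. (e(n := d)) i * c p i) = (\<Sum>i<n. e i * c p i) + d * c p n" for p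
    by simp
  then have "(\<Sum>p\<in>P. cosh (l * (\<Sum>i<Suc n. (e(n := d)) i * c p i))) = F d"
    unfolding F_def S_def by (simp only: distrib_left) (simp add: mult_ac)
  moreover have "\<forall>i. (e(n := d)) i \<in> {-1, 1}"
    using e d by auto
  ultimately show ?case
    using d(2) by (intro exI[of _ "e(n := d)"]) (simp only: simp_thms)
qed

text \<open>Taking \<open>l = 1 / sqrt n\<close> keeps the total exponential moment below
  \<open>card P * exp 1\<close>. Each single \<open>cosh\<close> is at most this total, so taking
  logarithms bounds all sums at once, and the number of tests enters only through its
  logarithm.\<close>

lemma exists_signs_small_sums:
  fixes c :: "'p \<Rightarrow> nat \<Rightarrow> real"
  assumes "finite P" "\<And>p i. p \<in> P \<Longrightarrow> \<bar>c p i\<bar> \<le> 1" and n: "1 \<le> n"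
  shows "\<exists>e. (\<forall>i. e i \<in> {-1, 1}) \<and>
    (\<forall>p\<in>P. \<bar>\<Sum>i<n. e i * c p i\<bar> \<le> sqrt n * (ln (2 * card P) + 1))"
proof -
  define l where "l = 1 / sqrt (real n)"
  have l: "0 < l" "l \<le> 1" "l\<^sup>2 * n = 1"
    using n by (auto simp: l_def power_divide)
  obtain e where e: "\<And>i. e i \<in> {-1, 1}"
    and le: "(\<Sum>p\<in>P. cosh (l * (\<Sum>i<n. e i * c p i))) \<le> card P * exp 1"
    using exists_signs_cosh_sum[of P c l n] assms(2) l by auto
  have "\<bar>\<Sum>i<n. e i * c p i\<bar> \<le> sqrt n * (ln (2 * card P) + 1)" if p: "p \<in> P" for p
  proof -
    define S where "S = (\<Sum>i<n. e i * c p i)"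
    have card: "0 < real (card P)"
      using p assms(1) card_gt_0_iff by fastforce
    have "exp (l * \<bar>S\<bar>) \<le> 2 * cosh (l * \<bar>S\<bar>)"
      by (simp add: cosh_def)
    also have "cosh (l * \<bar>S\<bar>) = cosh (l * S)"
      by (cases "0 \<le> S") auto
    also have "\<dots> \<le> (\<Sum>p\<in>P. cosh (l * (\<Sum>i<n. e i * c p i)))"
      unfolding S_def using p assms(1)
      by (intro member_le_sum[of p P "\<lambda>p. cosh (l * (\<Sum>i<n. e i * c p i))"]) auto
    finally have "exp (l * \<bar>S\<bar>) \<le> 2 * card P * exp 1"
      using le by simp
    then have "ln (exp (l * \<bar>S\<bar>)) \<le> ln (2 * card P * exp 1)"
      by (subst ln_le_cancel_iff) (use card in auto)
    then have "l * \<bar>S\<bar> \<le> ln (2 * card P) + 1"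
      using card by (simp add: ln_mult)
    then show ?thesis
      using n unfolding S_def l_def by (simp add: field_simps)
  qed
  then show ?thesis
    using e by blast
qed

lemma norm_cis_diff_le: "norm (cis x - cis y) \<le> \<bar>x - y\<bar>"
proof -
  have "cis x - cis y = cis y * (cis (x - y) - 1)"
    by (simp add: right_diff_distrib cis_mult)
  then have "norm (cis x - cis y) = norm (cis (x - y) - 1)"
    by (simp add: norm_mult)
  also have "\<dots> \<le> \<bar>x - y\<bar>"
    using iexp_approx1[of "x - y" 0] by (simp add: cis_conv_exp)
  finally show ?thesis .
qed

text \<open>This is the Salem--Zygmund bound for random signs, with \<open>j\<close> in place of its square root.
  The sum has period \<open>2 * pi * 2 ^ j\<close> in \<open>t\<close> and is Lipschitz, so it is enough to
  control it on \<open>4 ^ j\<close> points.\<close>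

lemma exists_signs_small_trigonometric_sum:
  fixes k :: "nat \<Rightarrow> nat"
  assumes k: "\<And>i. i < n \<Longrightarrow> k i < 2 ^ j" and n: "1 \<le> n" "n \<le> 2 ^ j"
  shows "\<exists>e :: nat \<Rightarrow> real. (\<forall>i. e i \<in> {-1, 1}) \<and>
    (\<forall>t::real. norm (\<Sum>i<n. of_real (e i) * cis (t * k i / 2 ^ j)) \<le> 13 * real (j + 1) * sqrt n)"
proof -
  \<comment> \<open>\<open>Q\<close> grid points of spacing \<open>h\<close> cover one period, since
    \<open>h * Q = 2 * pi * 2 ^ j\<close>.\<close>
  define Q :: nat where "Q = 4 ^ j"
  have Q: "0 < Q" unfolding Q_def by simp
  have QN: "real Q = 2 ^ j * 2 ^ j"
    by (simp add: Q_def power_mult_distrib[symmetric])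
  define h where "h = 2 * pi / 2 ^ j"
  have h: "0 < h" by (simp add: h_def)
  define z where "z = (\<lambda>(t::real) i. cis (t * k i / 2 ^ j))"
  \<comment> \<open>The sign lemma concerns real coefficients, so each grid point is tested for its
    real and its imaginary part. With \<open>2 * 4 ^ j\<close> tests the logarithm is linear in
    \<open>j\<close>.\<close>
  define c where "c = (\<lambda>(q::nat, b) i. if b then Re (z (h * q) i) else Im (z (h * q) i))"
  have "\<bar>c p i\<bar> \<le> 1" for p i
    by (auto simp: c_def z_def split: prod.splits)
  then have "\<exists>e. (\<forall>i. e i \<in> {-1, 1::real}) \<and> (\<forall>p\<in>{..<Q} \<times> (UNIV :: bool set).
      \<bar>\<Sum>i<n. e i * c p i\<bar> \<le> sqrt n * (ln (2 * card ({..<Q} \<times> (UNIV :: bool set))) + 1))"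
    using n by (intro exists_signs_small_sums) auto
  then obtain e where e: "\<And>i. e i \<in> {-1, 1::real}"
    and le: "\<And>p. p \<in> {..<Q} \<times> (UNIV :: bool set) \<Longrightarrow>
      \<bar>\<Sum>i<n. e i * c p i\<bar> \<le> sqrt n * (ln (2 * card ({..<Q} \<times> (UNIV :: bool set))) + 1)"
    by blast
  define S where "S = (\<lambda>t. \<Sum>i<n. of_real (e i) * z t i)"
  have logQ: "ln (2 * card ({..<Q} \<times> (UNIV :: bool set))) + 1 \<le> 2 * real j + 3"
  proof -
    have "2 * card ({..<Q} \<times> (UNIV :: bool set)) = 4 ^ (j + 1)"
      by (simp add: Q_def card_cartesian_product)
    then have "real (2 * card ({..<Q} \<times> (UNIV :: bool set))) = 4 ^ (j + 1)"
      by simp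
    then have "ln (2 * card ({..<Q} \<times> (UNIV :: bool set))) = real (j + 1) * ln 4"
      by (simp only: ln_realpow)
    also have "ln 4 = ln ((2::real) ^ 2)"
      by simp
    also have "real (j + 1) * \<dots> = 2 * real (j + 1) * ln 2"
      by (subst ln_realpow) auto
    also have "\<dots> \<le> 2 * real (j + 1) * 1"
      using ln_2_less_1 by (intro mult_left_mono) auto
    finally show ?thesis by simp
  qed
  have grid: "norm (S (h * q)) \<le> (4 * j + 6) * sqrt n" if "q < Q" for q :: nat
  proof -
    have "\<bar>Re (S (h * q))\<bar> \<le> sqrt n * (2 * real j + 3)"
    proof -
      have "Re (S (h * q)) = (\<Sum>i<n. e i * c (q, True) i)"
        by (simp add: S_def c_def)
      also have "\<bar>\<dots>\<bar> \<le> sqrt n * (ln (2 * card ({..<Q} \<times> (UNIV :: bool set))) + 1)"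
        using that by (intro le) simp
      also have "\<dots> \<le> sqrt n * (2 * real j + 3)"
        using logQ by (intro mult_left_mono) auto
      finally show ?thesis .
    qed
    moreover have "\<bar>Im (S (h * q))\<bar> \<le> sqrt n * (2 * real j + 3)"
    proof -
      have "Im (S (h * q)) = (\<Sum>i<n. e i * c (q, False) i)"
        by (simp add: S_def c_def)
      also have "\<bar>\<dots>\<bar> \<le> sqrt n * (ln (2 * card ({..<Q} \<times> (UNIV :: bool set))) + 1)"
        using that by (intro le) simp
      also have "\<dots> \<le> sqrt n * (2 * real j + 3)"
        using logQ by (intro mult_left_mono) auto
      finally show ?thesis .
    qed
    ultimately show ?thesis
      using cmod_le[of "S (h * q)"] by (simp add: algebra_simps)
  qed
  have "norm (S t) \<le> 13 * real (j + 1) * sqrt n" for t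
  proof -
    \<comment> \<open>\<open>h * m\<close> is the last grid point up to \<open>t\<close>, and
      \<open>q\<close> is its representative in the first period.\<close>
    define m where "m = \<lfloor>t / h\<rfloor>"
    define q where "q = nat (m mod int Q)"
    have q: "q < Q" "int q = m mod int Q"
      using Q by (auto simp: q_def nat_less_iff)
    have "m = int Q * (m div int Q) + int q"
      using q(2) by simp
    then have m: "real_of_int m = real Q * real_of_int (m div int Q) + real q"
      by (metis of_int_add of_int_mult of_int_of_nat_eq)
    have "z (h * m) i = z (h * q) i" for i
    proof -
      have "h * m * k i / 2 ^ j =
          h * q * k i / 2 ^ j + 2 * pi * of_int ((m div int Q) * int (k i))"
        by (simp add: m h_def QN field_simps)
      then show ?thesis
        unfolding z_def by (simp add: cis_mult[symmetric] cis_multiple_2pi)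
    qed
    then have Sm: "S (h * m) = S (h * q)"
      by (simp add: S_def)
    have dist: "\<bar>t - h * m\<bar> \<le> h"
    proof -
      have "of_int m * h \<le> t" "t \<le> (of_int m + 1) * h"
        unfolding m_def using h floor_divide_lower[of h t] floor_divide_upper[of h t] by auto
      then show ?thesis
        by (simp add: algebra_simps)
    qed
    \<comment> \<open>Moving \<open>t\<close> by at most \<open>h\<close> changes each term by at
      most \<open>h\<close>, because \<open>k i / 2 ^ j < 1\<close>. There are at most
      \<open>2 ^ j\<close> terms and \<open>2 ^ j * h = 2 * pi\<close>.\<close>
    have "norm (S t - S (h * m)) \<le> (\<Sum>i<n. norm (of_real (e i) * (z t i - z (h * m) i)))"
      unfolding S_def by (simp add: sum_subtractf[symmetric] right_diff_distrib[symmetric] norm_sum)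
    also have "\<dots> \<le> (\<Sum>i<n. h)"
    proof (intro sum_mono)
      fix i assume i: "i \<in> {..<n}"
      have "norm (of_real (e i) * (z t i - z (h * m) i)) = norm (z t i - z (h * m) i)"
        using e[of i] by (auto simp: norm_mult)
      also have "\<dots> \<le> \<bar>t * k i / 2 ^ j - h * m * k i / 2 ^ j\<bar>"
        unfolding z_def by (rule norm_cis_diff_le)
      also have "\<dots> = \<bar>t - h * m\<bar> * (k i / 2 ^ j)"
        by (simp add: abs_mult left_diff_distrib[symmetric] diff_divide_distrib[symmetric])
      also have "\<dots> \<le> h * 1"
      proof (intro mult_mono dist)
        have "real (k i) \<le> real (2 ^ j)"
          using k[of i] i by (intro of_nat_mono) auto
        then show "k i / 2 ^ j \<le> (1::real)" by simp
      qed (use h in auto)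
      finally show "norm (of_real (e i) * (z t i - z (h * m) i)) \<le> h" by simp
    qed
    also have "\<dots> \<le> 2 ^ j * h"
    proof -
      have "real n \<le> real (2 ^ j)" using n(2) by (intro of_nat_mono)
      then show ?thesis using h by (simp add: mult_right_mono)
    qed
    also have "\<dots> = 2 * pi" by (simp add: h_def)
    also have "\<dots> \<le> 7" using pi_approx by simp
    also have "\<dots> \<le> 7 * sqrt n" using n by simp
    finally have "norm (S t) \<le> 7 * sqrt n + (4 * j + 6) * sqrt n"
      using grid[OF q(1)] Sm norm_triangle_sub[of "S t" "S (h * m)"] by simp
    also have "\<dots> \<le> 13 * real (j + 1) * sqrt n"
      by (simp add: algebra_simps mult_right_mono)
    finally show ?thesis .
  qed
  then show ?thesis
    using e by (intro exI[of _ e] conjI allI) (simp_all add: S_def z_def)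
qed

section \<open>Random selections of dyadic intervals\<close>

text \<open>The characteristic function of the uniform distribution on [0, 1], with the removable
  singularity at 0 filled in.\<close>

definition unif_char :: "real \<Rightarrow> complex" where
  "unif_char t = (if t = 0 then 1 else (cis t - 1) / (\<i> * t))"

text \<open>The uniform distribution on [0, 2] is the average of the one on [0, 1] and its translate
  by 1.\<close>

lemma unif_char_double: "unif_char (2 * t) = (1 + cis t) / 2 * unif_char t"
proof (cases "t = 0")
  case False
  have "cis (2 * t) - 1 = (1 + cis t) * (cis t - 1)"
    by (simp add: algebra_simps cis_mult)
  then show ?thesis
    using False by (simp add: unif_char_def)
qed (simp add: unif_char_def)

lemma norm_unif_char_le_1: "norm (unif_char t) \<le> 1"
  using norm_cis_diff_le[of t 0] by (simp add: unif_char_def norm_divide norm_mult)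

lemma norm_unif_char_le: "norm (unif_char t) \<le> 2 / \<bar>t\<bar>" if "t \<noteq> 0"
proof -
  have "norm (cis t - 1) \<le> 2"
    using norm_triangle_ineq4[of "cis t" 1] by simp
  then show ?thesis
    using that by (simp add: unif_char_def norm_divide norm_mult divide_right_mono)
qed

text \<open>Interpolation: the smaller of 1 and \<open>y\<close> is at most \<open>y powr a\<close>
  whenever \<open>a\<close> lies between 0 and 1.\<close>

lemma norm_unif_char_le_powr:
  assumes "t \<noteq> 0" "0 \<le> a" "a \<le> 1"
  shows "norm (unif_char t) \<le> (2 / \<bar>t\<bar>) powr a"
proof (cases "2 / \<bar>t\<bar> \<le> 1")
  case True
  have "2 / \<bar>t\<bar> = (2 / \<bar>t\<bar>) powr 1"
    using assms by simp
  also have "\<dots> \<le> (2 / \<bar>t\<bar>) powr a"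
    using True assms by (intro powr_mono') auto
  finally show ?thesis
    using norm_unif_char_le[OF assms(1)] by linarith
next
  case False
  then have "1 \<le> (2 / \<bar>t\<bar>) powr a"
    using assms by (intro ge_one_powr_ge_zero) auto
  then show ?thesis
    using norm_unif_char_le_1[of t] by linarith
qed

lemma norm_unif_char_minus_1_le: "norm (unif_char t - 1) \<le> \<bar>t\<bar> / 2"
proof (cases "t = 0")
  case False
  have "unif_char t - 1 = (cis t - 1 - \<i> * t) / (\<i> * t)"
    using False by (simp add: unif_char_def field_simps)
  then have "norm (unif_char t - 1) = norm (cis t - 1 - \<i> * t) / \<bar>t\<bar>"
    by (simp add: norm_divide norm_mult)
  also have "\<dots> \<le> (\<bar>t\<bar>\<^sup>2 / 2) / \<bar>t\<bar>"
    using iexp_approx1[of t 1]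
    by (intro divide_right_mono) (simp_all add: cis_conv_exp power2_eq_square algebra_simps)
  finally show ?thesis
    using False by (simp add: power2_eq_square field_simps abs_if split: if_splits)
qed (simp add: unif_char_def)

lemma unif_char_dyadic_tendsto: "(\<lambda>j. unif_char (t / 2 ^ j)) \<longlonglongrightarrow> 1"
proof -
  have "(\<lambda>j. \<bar>t\<bar> / 2 * (1 / 2) ^ j) \<longlonglongrightarrow> 0"
    by (intro tendsto_mult_right_zero LIMSEQ_power_zero) simp
  then have "(\<lambda>j. unif_char (t / 2 ^ j) - 1) \<longlonglongrightarrow> 0"
  proof (rule Lim_null_comparison[rotated])
    show "\<forall>\<^sub>F j in sequentially. norm (unif_char (t / 2 ^ j) - 1) \<le> \<bar>t\<bar> / 2 * (1 / 2) ^ j"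
      using norm_unif_char_minus_1_le[of "t / 2 ^ j" for j]
      by (intro always_eventually allI) (simp add: power_divide abs_mult mult.commute)
  qed
  then show ?thesis
    by (simp add: LIM_zero_iff)
qed

section \<open>Uniform distributions on selected dyadic intervals\<close>

definition dyadic_selection :: "nat \<Rightarrow> nat \<Rightarrow> (nat \<Rightarrow> nat) \<Rightarrow> bool" where
  "dyadic_selection j n k \<longleftrightarrow> inj_on k {..<n} \<and> k ` {..<n} \<subseteq> {..<2 ^ j}"

text \<open>For a selection \<open>k\<close> of \<open>n > 0\<close> intervals, this is the
  characteristic function of the uniform distribution on their union: the sum runs over the left
  endpoints, and the last factor belongs to a single interval of length
  \<open>1 / 2 ^ j\<close>.\<close>

definition selection_char :: "nat \<Rightarrow> nat \<Rightarrow> (nat \<Rightarrow> nat) \<Rightarrow> real \<Rightarrow> complex" where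
  "selection_char j n k t = (\<Sum>i<n. cis (t * k i / 2 ^ j)) / of_nat n * unif_char (t / 2 ^ j)"

lemma dyadic_selection_card_le: "n \<le> 2 ^ j" if "dyadic_selection j n k"
  using that card_inj_on_le[of k "{..<n}" "{..<2 ^ j}"] by (simp add: dyadic_selection_def)

text \<open>Cutting every interval in two does not change the union, hence not the transform. The
  halves of interval \<open>i\<close> get the positions \<open>2 * i\<close> and
  \<open>2 * i + 1\<close>, so \<open>div 2\<close> leads back to the parent.\<close>

lemma dyadic_selection_split:
  assumes "dyadic_selection j n k" "1 \<le> n"
  defines "k' \<equiv> \<lambda>i. 2 * k (i div 2) + i mod 2"
  shows "dyadic_selection (Suc j) (2 * n) k'"
    and "selection_char (Suc j) (2 * n) k' t = selection_char j n k t"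
proof -
  have "inj_on k' {..<2 * n}"
  proof (rule inj_onI)
    fix x y assume xy: "x \<in> {..<2 * n}" "y \<in> {..<2 * n}" "k' x = k' y"
    have "k' i div 2 = k (i div 2)" "k' i mod 2 = i mod 2" for i
      by (simp_all add: k'_def)
    then have "k (x div 2) = k (y div 2)" "x mod 2 = y mod 2"
      using xy(3) by metis+
    moreover have "x div 2 < n" "y div 2 < n"
      using xy by auto
    ultimately have "x div 2 = y div 2" "x mod 2 = y mod 2"
      using assms(1) by (auto simp: dyadic_selection_def dest: inj_onD)
    then show "x = y"
      by (metis mult_div_mod_eq)
  qed
  moreover have "k' i < 2 ^ Suc j" if "i < 2 * n" for i
  proof -
    have "k (i div 2) < 2 ^ j"
      using that assms(1) by (simp add: dyadic_selection_def image_subset_iff)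
    moreover have "i mod 2 < 2" by simp
    ultimately show ?thesis
      unfolding k'_def power_Suc by linarith
  qed
  ultimately show "dyadic_selection (Suc j) (2 * n) k'"
    by (auto simp: dyadic_selection_def)
  define u where "u = t / 2 ^ Suc j"
  have u: "t / 2 ^ j = 2 * u" by (simp add: u_def)
  have "(\<Sum>i<2 * N. cis (t * k' i / 2 ^ Suc j)) = (1 + cis u) * (\<Sum>i<N. cis (t * k i / 2 ^ j))" for N
  proof (induction N)
    case (Suc N)
    have "cis (t * k' (2 * N) / 2 ^ Suc j) = cis (t * k N / 2 ^ j)"
      by (simp add: k'_def)
    moreover have "k' (Suc (2 * N)) = 2 * k N + 1"
      by (simp add: k'_def)
    then have "cis (t * k' (Suc (2 * N)) / 2 ^ Suc j) = cis u * cis (t * k N / 2 ^ j)"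
      by (simp add: k'_def u_def cis_mult field_simps)
    ultimately show ?case
      using Suc by (simp add: algebra_simps)
  qed simp
  then show "selection_char (Suc j) (2 * n) k' t = selection_char j n k t"
    unfolding selection_char_def u u_def[symmetric] unif_char_double
    by (simp add: mult_ac)
qed

text \<open>Both halves of an interval together carry the factor \<open>(1 + cis u) / 2\<close>.
  Keeping one half replaces it by 1 or \<open>cis u\<close>, a change of plus or minus
  \<open>(1 - cis u) / 2\<close>. The changes add up to the trigonometric sum with chosen signs, and
  its bound of order \<open>j * sqrt n\<close> is divided by \<open>n\<close>.\<close>

lemma dyadic_selection_choose:
  assumes k: "dyadic_selection j n k" and n: "1 \<le> n"
  shows "\<exists>k'. dyadic_selection (Suc j) n k' \<and> (\<forall>i<n. k' i div 2 = k i) \<and>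
    (\<forall>t. norm (selection_char (Suc j) n k' t - selection_char j n k t) \<le>
      13 * real (j + 1) / sqrt n * norm (unif_char (t / 2 ^ Suc j)))"
proof -
  have less: "k i < 2 ^ j" if "i < n" for i
    using that k by (auto simp: dyadic_selection_def)
  obtain e :: "nat \<Rightarrow> real" where e: "\<And>i. e i \<in> {-1, 1}"
    and le: "\<And>t::real. norm (\<Sum>i<n. of_real (e i) * cis (t * k i / 2 ^ j)) \<le> 13 * real (j + 1) * sqrt n"
    using exists_signs_small_trigonometric_sum[of n k j, OF less n dyadic_selection_card_le[OF k]]
    by blast
  \<comment> \<open>Sign 1 keeps the left half, sign -1 the right half.\<close>
  define k' where "k' = (\<lambda>i. 2 * k i + (if e i = 1 then 0 else 1))"
  have k': "k' i div 2 = k i" for i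
    by (simp add: k'_def)
  have "inj_on k' {..<n}"
    using k k' unfolding dyadic_selection_def inj_on_def by metis
  moreover have "k' i < 2 ^ Suc j" if "i < n" for i
    using less[OF that] unfolding k'_def power_Suc by simp
  ultimately have "dyadic_selection (Suc j) n k'"
    by (auto simp: dyadic_selection_def)
  moreover have "norm (selection_char (Suc j) n k' t - selection_char j n k t) \<le>
      13 * real (j + 1) / sqrt n * norm (unif_char (t / 2 ^ Suc j))" for t
  proof -
    define u where "u = t / 2 ^ Suc j"
    have u: "t / 2 ^ j = 2 * u" by (simp add: u_def)
    have summand: "cis (t * k' i / 2 ^ Suc j) - (1 + cis u) / 2 * cis (t * k i / 2 ^ j) =
        (1 - cis u) / 2 * (of_real (e i) * cis (t * k i / 2 ^ j))" for i
    proof (cases "e i = 1")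
      case True
      then have "cis (t * k' i / 2 ^ Suc j) = cis (t * k i / 2 ^ j)"
        by (simp add: k'_def)
      then show ?thesis using True by (simp add: field_simps)
    next
      case False
      then have "e i = -1" using e[of i] by simp
      moreover have "cis (t * k' i / 2 ^ Suc j) = cis u * cis (t * k i / 2 ^ j)"
        using False by (simp add: k'_def u_def cis_mult field_simps)
      ultimately show ?thesis by (simp add: field_simps)
    qed
    have "selection_char (Suc j) n k' t - selection_char j n k t =
        (\<Sum>i<n. cis (t * k' i / 2 ^ Suc j) - (1 + cis u) / 2 * cis (t * k i / 2 ^ j)) / of_nat n
          * unif_char u"
      unfolding selection_char_def u u_def[symmetric] unif_char_double sum_subtractf
        sum_distrib_left[symmetric]
      by (simp add: diff_divide_distrib algebra_simps)
    also have "\<dots> = (1 - cis u) / 2 * (\<Sum>i<n. of_real (e i) * cis (t * k i / 2 ^ j)) / of_nat n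
          * unif_char u"
      by (simp only: summand sum_distrib_left)
    also have "norm \<dots> = norm ((1 - cis u) / 2) *
        norm (\<Sum>i<n. of_real (e i) * cis (t * k i / 2 ^ j)) / n * norm (unif_char u)"
      by (simp add: norm_mult norm_divide)
    also have "\<dots> \<le> 1 * (13 * real (j + 1) * sqrt n) / n * norm (unif_char u)"
    proof (intro mult_right_mono divide_right_mono mult_mono le)
      show "norm ((1 - cis u) / 2) \<le> 1"
        using norm_triangle_ineq4[of 1 "cis u"] by (simp add: norm_divide)
    qed (use le[of t] in auto)
    also have "\<dots> = 13 * real (j + 1) * (sqrt n / n) * norm (unif_char u)"
      by simp
    also have "\<dots> = 13 * real (j + 1) / sqrt n * norm (unif_char u)"
      using sqrt_divide_self_eq[of n] by (simp add: divide_inverse)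
    finally show ?thesis by (simp add: u_def)
  qed
  ultimately show ?thesis
    using k' by blast
qed

text \<open>Dependent choice over the two kinds of step. The exponent \<open>m (Suc j) - m j\<close>
  is 1 when both halves are kept and 0 when one is, so a single formula gives the position of the
  parent. In the first case the transform does not change at all.\<close>

lemma exists_cascade:
  fixes m :: "nat \<Rightarrow> nat"
  assumes m: "m 0 = 0" "\<And>j. m (Suc j) = m j \<or> m (Suc j) = Suc (m j)"
  shows "\<exists>k. \<forall>j. dyadic_selection j (2 ^ m j) (k j) \<and>
    (\<forall>i<2 ^ m (Suc j). k (Suc j) i div 2 = k j (i div 2 ^ (m (Suc j) - m j))) \<and>
    (\<forall>t. norm (selection_char (Suc j) (2 ^ m (Suc j)) (k (Suc j)) t
        - selection_char j (2 ^ m j) (k j) t)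
      \<le> 13 * real (j + 1) / sqrt (2 ^ m j) * norm (unif_char (t / 2 ^ Suc j)))"
    (is "\<exists>k. \<forall>j. ?P j (k j) \<and> ?Q j (k j) (k (Suc j)) \<and> ?R j (k j) (k (Suc j))")
proof -
  have step: "\<exists>k'. ?P (Suc j) k' \<and> ?Q j k k' \<and> ?R j k k'" if k: "?P j k" for j k
  proof (cases "m (Suc j) = m j")
    case True
    then show ?thesis
      using dyadic_selection_choose[OF k] by simp
  next
    case False
    then have Suc: "m (Suc j) = Suc (m j)"
      using m(2)[of j] by simp
    show ?thesis
      unfolding Suc using dyadic_selection_split[OF k]
      by (intro exI[of _ "\<lambda>i. 2 * k (i div 2) + i mod 2"]) (auto simp: Suc_diff_le)
  qed
  have init: "?P 0 (\<lambda>_. 0)"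
    by (simp add: m dyadic_selection_def inj_on_def)
  show ?thesis
    by (rule dependent_nat_choice) (rule exI, rule init, rule step)
qed

section \<open>A Salem measure of dimension \<open>s\<close>\<close>

text \<open>The division by \<open>2 ^ d\<close> drops the last \<open>d\<close> of the first
  \<open>a + d\<close> binary digits of \<open>w\<close>.\<close>

lemma nat_floor_dyadic_div:
  fixes w :: real
  assumes "0 \<le> w"
  shows "nat \<lfloor>w * 2 ^ (a + d)\<rfloor> div 2 ^ d = nat \<lfloor>w * 2 ^ a\<rfloor>"
proof -
  have "\<lfloor>w * 2 ^ (a + d)\<rfloor> div 2 ^ d = \<lfloor>w * 2 ^ (a + d) / real_of_int (2 ^ d)\<rfloor>"
    by (subst floor_divide_real_eq_div) auto
  also have "w * 2 ^ (a + d) / real_of_int (2 ^ d) = w * 2 ^ a"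
    by (simp add: power_add)
  finally have "nat \<lfloor>w * 2 ^ a\<rfloor> = nat (\<lfloor>w * 2 ^ (a + d)\<rfloor> div 2 ^ d)"
    by simp
  also have "\<dots> = nat \<lfloor>w * 2 ^ (a + d)\<rfloor> div nat (2 ^ d)"
    using assms by (intro nat_div_distrib) auto
  finally show ?thesis
    by (simp add: nat_power_eq)
qed

lemma nat_floor_eq_iff: "nat \<lfloor>w\<rfloor> = i \<longleftrightarrow> real i \<le> w \<and> w < real i + 1" if "0 \<le> w" for w :: real
proof -
  have "nat \<lfloor>w\<rfloor> = i \<longleftrightarrow> \<lfloor>w\<rfloor> = int i"
    using that by auto
  then show ?thesis
    by (simp add: floor_eq_iff)
qed

lemma norm_limit_le_suminf:
  fixes X :: "nat \<Rightarrow> 'a::real_normed_vector"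
  assumes "X \<longlonglongrightarrow> L" "summable a" "\<And>j. norm (X (Suc j) - X j) \<le> a j"
  shows "norm L \<le> norm (X 0) + suminf a"
proof (rule Lim_norm_ubound[OF _ assms(1)])
  have "norm (X n) \<le> norm (X 0) + (\<Sum>j<n. a j)" for n
  proof (induction n)
    case (Suc n)
    then show ?case
      using assms(3)[of n] norm_triangle_sub[of "X (Suc n)" "X n"] by simp
  qed simp
  moreover have "(\<Sum>j<n. a j) \<le> suminf a" for n
    using assms(2) order_trans[OF norm_ge_zero assms(3)] by (intro sum_le_suminf) auto
  ultimately show "\<forall>\<^sub>F n in sequentially. norm (X n) \<le> norm (X 0) + suminf a"
    by (intro always_eventually allI) (metis add_left_mono order_trans)
qed simp

section \<open>The limit law of a nested cascade\<close>

locale cascade =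
  fixes m :: "nat \<Rightarrow> nat" and k :: "nat \<Rightarrow> nat \<Rightarrow> nat"
  assumes m_0: "m 0 = 0" and m_Suc: "m (Suc j) = m j \<or> m (Suc j) = Suc (m j)"
    and selection: "dyadic_selection j (2 ^ m j) (k j)"
    and parent: "i < 2 ^ m (Suc j) \<Longrightarrow> k (Suc j) i div 2 = k j (i div 2 ^ (m (Suc j) - m j))"
begin

text \<open>The limit law is a push-forward of the uniform law. The first \<open>m j\<close> binary
  digits of \<open>w\<close> give a position in the selection of level \<open>j\<close>,
  \<open>left j w\<close> is the left endpoint of the interval there, and as \<open>j\<close> grows
  these intervals shrink to \<open>point w\<close>.\<close>

definition idx :: "nat \<Rightarrow> real \<Rightarrow> nat" where
  "idx j w = nat \<lfloor>w * 2 ^ m j\<rfloor>"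

definition left :: "nat \<Rightarrow> real \<Rightarrow> real" where
  "left j w = k j (idx j w) / 2 ^ j"

definition point :: "real \<Rightarrow> real" where
  "point w = lim (\<lambda>j. left j w)"

definition unif :: "real measure" where
  "unif = uniform_measure lborel {0..<1}"

definition law :: "real measure" where
  "law = distr unif borel point"

sublocale U: prob_space unif
  unfolding unif_def by (rule prob_space_uniform_measure) auto

lemma sets_unif [simp, measurable_cong]: "sets unif = sets borel"
  by (simp add: unif_def)

lemma space_unif [simp]: "space unif = UNIV"
  by (simp add: unif_def)

lemma AE_unif: "AE w in unif. 0 \<le> w \<and> w < 1"
  unfolding unif_def by (rule AE_uniform_measureI) auto

lemma measurable_idx [measurable]: "idx j \<in> borel \<rightarrow>\<^sub>M count_space UNIV"
  unfolding idx_def by measurable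

lemma measurable_left [measurable]: "left j \<in> borel_measurable borel"
  unfolding left_def by measurable

lemma measurable_point [measurable]: "point \<in> borel_measurable borel"
  unfolding point_def by measurable

lemma idx_less: "idx j w < 2 ^ m j" if "0 \<le> w" "w < 1"
proof -
  have "w * 2 ^ m j < 2 ^ m j"
    using that by simp
  then have "\<lfloor>w * 2 ^ m j\<rfloor> < 2 ^ m j"
    by (simp add: floor_less_iff)
  then show ?thesis
    using that by (simp add: idx_def nat_less_iff)
qed

lemma left_step:
  assumes "0 \<le> w" "w < 1"
  shows "left j w \<le> left (Suc j) w" "left (Suc j) w + 1 / 2 ^ Suc j \<le> left j w + 1 / 2 ^ j"
proof -
  \<comment> \<open>Passing from position \<open>idx (Suc j) w\<close> to \<open>idx j w\<close>
    drops \<open>d\<close> digits, which is the passage to the parent. So the intervals followed by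
    a fixed \<open>w\<close> are nested.\<close>
  define d where "d = m (Suc j) - m j"
  have "m (Suc j) = m j + d"
    using m_Suc[of j] by (auto simp: d_def)
  then have "idx (Suc j) w div 2 ^ d = idx j w"
    unfolding idx_def using nat_floor_dyadic_div[OF assms(1), of "m j" d] by simp
  then have "k (Suc j) (idx (Suc j) w) div 2 = k j (idx j w)"
    using parent[OF idx_less[OF assms]] by (simp add: d_def)
  then have "2 * k j (idx j w) \<le> k (Suc j) (idx (Suc j) w)"
    "k (Suc j) (idx (Suc j) w) \<le> 2 * k j (idx j w) + 1"
    by linarith+
  then have *: "2 * real (k j (idx j w)) \<le> real (k (Suc j) (idx (Suc j) w))"
    "real (k (Suc j) (idx (Suc j) w)) + 1 \<le> 2 * real (k j (idx j w)) + 2"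
    by linarith+
  have left_j: "left j w = (2 * real (k j (idx j w))) / 2 ^ Suc j"
    and unit: "1 / 2 ^ j = 2 / (2 ^ Suc j :: real)"
    by (simp_all add: left_def)
  show "left j w \<le> left (Suc j) w"
    unfolding left_j unfolding left_def by (intro divide_right_mono *) simp
  show "left (Suc j) w + 1 / 2 ^ Suc j \<le> left j w + 1 / 2 ^ j"
    unfolding left_j unit unfolding left_def add_divide_distrib[symmetric]
    by (intro divide_right_mono *) simp
qed

lemma left_point:
  assumes "0 \<le> w" "w < 1"
  shows "(\<lambda>j. left j w) \<longlonglongrightarrow> point w" "left j w \<le> point w" "point w \<le> left j w + 1 / 2 ^ j"
proof -
  have "(\<lambda>j. - ((1 / 2 :: real) ^ j)) \<longlonglongrightarrow> - 0"
    by (intro tendsto_minus LIMSEQ_power_zero) simp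
  then have "(\<lambda>j. left j w - (left j w + 1 / 2 ^ j)) \<longlonglongrightarrow> 0"
    by (simp add: power_divide)
  then have "\<exists>l. ((\<forall>n. left n w \<le> l) \<and> (\<lambda>j. left j w) \<longlonglongrightarrow> l) \<and>
      ((\<forall>n. l \<le> left n w + 1 / 2 ^ n) \<and> (\<lambda>j. left j w + 1 / 2 ^ j) \<longlonglongrightarrow> l)"
    using left_step[OF assms] by (intro nested_sequence_unique) auto
  then obtain l where l: "\<And>n. left n w \<le> l" "(\<lambda>j. left j w) \<longlonglongrightarrow> l" "\<And>n. l \<le> left n w + 1 / 2 ^ n"
    by blast
  moreover have "point w = l"
    unfolding point_def by (rule limI) (rule l(2))
  ultimately show "(\<lambda>j. left j w) \<longlonglongrightarrow> point w" "left j w \<le> point w" "point w \<le> left j w + 1 / 2 ^ j"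
    by auto
qed

lemma prob_idx: "U.prob {w. idx j w = i} = 1 / 2 ^ m j" if "i < 2 ^ m j"
proof -
  have "{0..<1} \<inter> {w. idx j w = i} = {i / 2 ^ m j..<(i + 1) / 2 ^ m j}"
  proof -
    have "real i + 1 \<le> 2 ^ m j"
      using that by (metis Suc_eq_plus1 Suc_leI of_nat_1 of_nat_add of_nat_le_iff of_nat_numeral of_nat_power)
    moreover define a b where "a = real i / 2 ^ m j" "b = (real i + 1) / 2 ^ m j"
    ultimately have ab: "0 \<le> a" "b \<le> 1"
      by auto
    have iff: "idx j w = i \<longleftrightarrow> a \<le> w \<and> w < b" if "0 \<le> w" for w
      using nat_floor_eq_iff[of "w * 2 ^ m j" i] that by (simp add: idx_def a_b_def field_simps)
    have "{0..<1} \<inter> {w. idx j w = i} = {a..<b}"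
      using ab iff by force
    then show ?thesis
      by (simp add: a_b_def add.commute)
  qed
  moreover have "real i / 2 ^ m j \<le> (real i + 1) / 2 ^ m j"
    by (intro divide_right_mono) auto
  ultimately show ?thesis
    unfolding unif_def
    by (subst measure_uniform_measure) (auto simp: diff_divide_distrib[symmetric] add.commute)
qed

lemma integral_idx:
  fixes f :: "nat \<Rightarrow> complex"
  shows "(\<integral>w. f (idx j w) \<partial>unif) = (\<Sum>i<2 ^ m j. f i) / 2 ^ m j"
proof -
  have "(\<integral>w. f (idx j w) \<partial>unif) =
      (\<integral>w. (\<Sum>i<2 ^ m j. indicator {w. idx j w = i} w *\<^sub>R f i) \<partial>unif)"
  proof (rule integral_cong_AE)
    show "AE w in unif. f (idx j w) = (\<Sum>i<2 ^ m j. indicator {w. idx j w = i} w *\<^sub>R f i)"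
      using AE_unif
    proof eventually_elim
      case (elim w)
      have "(\<Sum>i<2 ^ m j. indicator {w. idx j w = i} w *\<^sub>R f i) =
          (\<Sum>i<2 ^ m j. if i = idx j w then f i else 0)"
        by (intro sum.cong) (auto simp: indicator_def)
      then show ?case
        using idx_less[of w j] elim by simp
    qed
  qed measurable
  also have "\<dots> = (\<Sum>i<2 ^ m j. \<integral>w. indicator {w. idx j w = i} w *\<^sub>R f i \<partial>unif)"
    by (intro Bochner_Integration.integral_sum integrable_scaleR_left integrable_real_indicator)
      (auto simp: U.emeasure_eq_measure)
  also have "\<dots> = (\<Sum>i<2 ^ m j. (1 / 2 ^ m j) *\<^sub>R f i)"
  proof (intro sum.cong refl)
    fix i assume "i \<in> {..<2 ^ m j :: nat}"
    then show "(\<integral>w. indicator {w. idx j w = i} w *\<^sub>R f i \<partial>unif) = (1 / 2 ^ m j) *\<^sub>R f i"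
      using prob_idx[of i j]
      by (subst integral_scaleR_left) (auto intro!: integrable_real_indicator simp: U.emeasure_eq_measure)
  qed
  finally show ?thesis
    by (simp add: sum_divide_distrib scaleR_conv_of_real)
qed

lemma real_distribution_law: "real_distribution law"
  unfolding law_def by (rule U.real_distribution_distr) measurable

text \<open>The mean of \<open>cis (t * left j w)\<close> is exactly the normalised sum over left
  endpoints in \<open>selection_char\<close>. It converges by dominated convergence, and the factor
  of the single short interval tends to 1.\<close>

lemma selection_char_tendsto: "(\<lambda>j. selection_char j (2 ^ m j) (k j) t) \<longlonglongrightarrow> char law t"
proof -
  have "char law t = (\<integral>w. cis (t * point w) \<partial>unif)"
    unfolding char_def law_def by (subst integral_distr) (auto simp: cis_conv_exp)
  moreover have "(\<lambda>j. \<integral>w. cis (t * left j w) \<partial>unif) \<longlonglongrightarrow> (\<integral>w. cis (t * point w) \<partial>unif)"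
  proof (rule integral_dominated_convergence[where w = "\<lambda>_. 1"])
    show "AE w in unif. (\<lambda>j. cis (t * left j w)) \<longlonglongrightarrow> cis (t * point w)"
      using AE_unif by eventually_elim (auto intro!: tendsto_intros left_point)
  qed (auto simp: cis_conv_exp)
  ultimately have "(\<lambda>j. (\<integral>w. cis (t * left j w) \<partial>unif) * unif_char (t / 2 ^ j)) \<longlonglongrightarrow> char law t * 1"
    using tendsto_mult[OF _ unif_char_dyadic_tendsto] by metis
  moreover have "(\<integral>w. cis (t * left j w) \<partial>unif) * unif_char (t / 2 ^ j) =
      selection_char j (2 ^ m j) (k j) t" for j
    using integral_idx[of "\<lambda>i. cis (t * k j i / 2 ^ j)" j] by (simp add: left_def selection_char_def)
  ultimately show ?thesis
    by simp
qed

lemma law_cover: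
  "\<exists>K\<subseteq>{..<2 ^ j}. card K \<le> 2 ^ m j \<and>
    (AE x in law. \<exists>i\<in>K. real i / 2 ^ j \<le> x \<and> x \<le> (real i + 1) / 2 ^ j)"
proof (intro exI[of _ "k j ` {..<2 ^ m j}"] conjI)
  show "k j ` {..<2 ^ m j} \<subseteq> {..<2 ^ j}"
    using selection[of j] by (simp add: dyadic_selection_def)
  show "card (k j ` {..<2 ^ m j}) \<le> 2 ^ m j"
    using card_image_le[of "{..<2 ^ m j}" "k j"] by simp
  have "AE w in unif. \<exists>i\<in>k j ` {..<2 ^ m j}. real i / 2 ^ j \<le> point w \<and> point w \<le> (real i + 1) / 2 ^ j"
    using AE_unif
  proof eventually_elim
    case (elim w)
    then show ?case
      using idx_less[of w j] left_point(2,3)[of w j]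
      by (intro bexI[of _ "k j (idx j w)"]) (auto simp: left_def add_divide_distrib)
  qed
  then show "AE x in law. \<exists>i\<in>k j ` {..<2 ^ m j}. real i / 2 ^ j \<le> x \<and> x \<le> (real i + 1) / 2 ^ j"
    unfolding law_def by (subst AE_distr_iff) measurable
qed

text \<open>If \<open>point w\<close> lies in the ball, then \<open>left j w\<close> is within
  \<open>2 / 2 ^ j\<close> of \<open>x\<close>. Hence \<open>k j (idx j w)\<close> is one of at most
  5 integers, and each selected interval is chosen with probability
  \<open>1 / 2 ^ m j\<close>.\<close>

lemma law_cball_le: "measure law (cball x (1 / 2 ^ j)) \<le> 5 / 2 ^ m j"
proof -
  define Z where "Z = {\<lceil>x * 2 ^ j - 2\<rceil>..\<lfloor>x * 2 ^ j + 2\<rfloor>}"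
  define I where "I = {i\<in>{..<2 ^ m j}. int (k j i) \<in> Z}"
  have [simp]: "finite I"
    by (simp add: I_def)
  have "card I \<le> card Z"
  proof (rule card_inj_on_le)
    show "inj_on (\<lambda>i. int (k j i)) I"
      using selection[of j] by (auto simp: dyadic_selection_def I_def inj_on_def)
  qed (auto simp: I_def Z_def)
  also have "\<dots> \<le> 5"
    unfolding Z_def card_atLeastAtMost_int by linarith
  finally have card: "card I \<le> 5" .
  have "measure law (cball x (1 / 2 ^ j)) = U.prob (point -` cball x (1 / 2 ^ j))"
    unfolding law_def by (subst measure_distr) auto
  also have "\<dots> \<le> U.prob (\<Union>i\<in>I. {w. idx j w = i})"
  proof (rule U.finite_measure_mono_AE)
    show "AE w in unif. w \<in> point -` cball x (1 / 2 ^ j) \<longrightarrow> w \<in> (\<Union>i\<in>I. {w. idx j w = i})"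
      using AE_unif
    proof eventually_elim
      case (elim w)
      have "idx j w \<in> I" if "\<bar>x - point w\<bar> \<le> 1 / 2 ^ j"
      proof -
        have "\<bar>x - left j w\<bar> \<le> 2 / 2 ^ j"
          using left_point(2,3)[of w j] elim that by simp
        then have "\<bar>x - left j w\<bar> * 2 ^ j \<le> 2"
          by (simp add: field_simps)
        then have "\<bar>(x - left j w) * 2 ^ j\<bar> \<le> 2"
          by (simp add: abs_mult)
        then have "\<bar>x * 2 ^ j - k j (idx j w)\<bar> \<le> 2"
          by (simp add: left_def left_diff_distrib)
        then have "int (k j (idx j w)) \<in> Z"
          unfolding Z_def atLeastAtMost_iff ceiling_le_iff le_floor_iff by auto
        then show ?thesis
          using idx_less[of w j] elim by (simp add: I_def)
      qed
      then show ?case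
        by (auto simp: dist_real_def)
    qed
  qed measurable
  also have "\<dots> \<le> (\<Sum>i\<in>I. U.prob {w. idx j w = i})"
    by (rule U.finite_measure_subadditive_finite) auto
  also have "\<dots> = (\<Sum>i\<in>I. 1 / 2 ^ m j)"
    using prob_idx by (intro sum.cong) (auto simp: I_def)
  also have "\<dots> \<le> 5 / 2 ^ m j"
    using card by (simp add: divide_right_mono)
  finally show ?thesis .
qed

end

text \<open>The transform of the limit is bounded by the one at level 0 plus the changes between
  levels. The change at level \<open>j\<close> is of order \<open>j * 2 powr (- s * j / 2)\<close>
  times the transform of an interval of length \<open>1 / 2 ^ Suc j\<close>, for which interpolation
  gives the order \<open>2 powr (a * j) * |t| powr - a\<close>. The series converges because
  \<open>a < s / 2\<close>.\<close>

lemma exists_salem_measure: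
  fixes s :: real
  assumes s: "0 < s" "s \<le> 1"
  shows "\<exists>\<nu>. real_distribution \<nu> \<and>
    (\<forall>j. \<exists>K\<subseteq>{..<2 ^ j}. card K \<le> 2 powr (s * j) \<and>
      (AE x in \<nu>. \<exists>i\<in>K. real i / 2 ^ j \<le> x \<and> x \<le> (real i + 1) / 2 ^ j)) \<and>
    (\<exists>C. \<forall>x r. 0 < r \<and> r \<le> 1 \<longrightarrow> measure \<nu> (cball x r) \<le> C * r powr s) \<and>
    (\<forall>a. 0 \<le> a \<and> a < s / 2 \<longrightarrow> (\<exists>C. \<forall>t. t \<noteq> 0 \<longrightarrow> norm (char \<nu> t) \<le> C * \<bar>t\<bar> powr - a))"
proof -
  \<comment> \<open>Since \<open>0 < s <= 1\<close>, the rounded value grows by 0 or 1 per level.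
    Rounding costs at most a factor 2 in \<open>2 ^ m j\<close>.\<close>
  define m where "m = (\<lambda>j::nat. nat \<lfloor>s * j\<rfloor>)"
  have m_0: "m 0 = 0"
    by (simp add: m_def)
  have m_Suc: "m (Suc j) = m j \<or> m (Suc j) = Suc (m j)" for j
  proof -
    have "\<lfloor>s * j\<rfloor> \<le> \<lfloor>s * Suc j\<rfloor>" "\<lfloor>s * Suc j\<rfloor> \<le> \<lfloor>s * j + 1\<rfloor>"
      using s by (intro floor_mono; simp add: algebra_simps)+
    then have "\<lfloor>s * Suc j\<rfloor> = \<lfloor>s * j\<rfloor> \<or> \<lfloor>s * Suc j\<rfloor> = \<lfloor>s * j\<rfloor> + 1"
      by auto
    moreover have "0 \<le> \<lfloor>s * j\<rfloor>"
      using s by simp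
    ultimately show ?thesis
      unfolding m_def by (auto simp: nat_add_distrib simp del: of_nat_Suc)
  qed
  have power_m: "(2::real) ^ m j \<le> 2 powr (s * j)" "2 powr (s * j) / 2 \<le> (2::real) ^ m j" for j
  proof -
    have "0 \<le> \<lfloor>s * j\<rfloor>"
      using s by simp
    then have "real (m j) = of_int \<lfloor>s * j\<rfloor>"
      by (simp add: m_def)
    then have m: "real (m j) \<le> s * j" "s * j - 1 \<le> real (m j)"
      by linarith+
    have eq: "(2::real) ^ m j = 2 powr real (m j)"
      by (simp add: powr_realpow)
    show "(2::real) ^ m j \<le> 2 powr (s * j)"
      unfolding eq using m by (intro powr_mono) auto
    have "2 powr (s * j) / 2 = 2 powr (s * j - 1)"
      by (simp add: powr_diff)
    also have "\<dots> \<le> 2 powr real (m j)"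
      using m by (intro powr_mono) auto
    finally show "2 powr (s * j) / 2 \<le> (2::real) ^ m j"
      unfolding eq .
  qed
  obtain k where k: "\<And>j. dyadic_selection j (2 ^ m j) (k j)"
      "\<And>j i. i < 2 ^ m (Suc j) \<Longrightarrow> k (Suc j) i div 2 = k j (i div 2 ^ (m (Suc j) - m j))"
    and diff: "\<And>j t. norm (selection_char (Suc j) (2 ^ m (Suc j)) (k (Suc j)) t
        - selection_char j (2 ^ m j) (k j) t)
      \<le> 13 * real (j + 1) / sqrt (2 ^ m j) * norm (unif_char (t / 2 ^ Suc j))"
    using exists_cascade[of m, OF m_0 m_Suc] by blast
  interpret cascade m k
    using m_0 m_Suc k by unfold_locales auto
  have "\<exists>K\<subseteq>{..<2 ^ j}. card K \<le> 2 powr (s * j) \<and>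
      (AE x in law. \<exists>i\<in>K. real i / 2 ^ j \<le> x \<and> x \<le> (real i + 1) / 2 ^ j)" for j
  proof -
    obtain K where K: "K \<subseteq> {..<2 ^ j}" "card K \<le> 2 ^ m j"
        "AE x in law. \<exists>i\<in>K. real i / 2 ^ j \<le> x \<and> x \<le> (real i + 1) / 2 ^ j"
      using law_cover by blast
    have "real (card K) \<le> 2 ^ m j"
      using of_nat_mono[OF K(2), where ?'a = real] by simp
    then show ?thesis
      using K order_trans[OF _ power_m(1)[of j]] by (intro exI[of _ K]) blast
  qed
  moreover have "measure law (cball x r) \<le> 20 * r powr s" if r: "0 < r" "r \<le> 1" for x r
  proof -
    \<comment> \<open>The level with \<open>1 / 2 ^ Suc j < r <= 1 / 2 ^ j\<close>. The constant 20
      consists of 5 intervals, a factor 2 for the rounding in \<open>m\<close>, and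
      \<open>2 powr s <= 2\<close> for replacing \<open>1 / 2 ^ j\<close> by
      \<open>r\<close>.\<close>
    define j where "j = nat \<lfloor>- log 2 r\<rfloor>"
    have "0 \<le> - log 2 r"
      using r by (simp add: log_le_zero_cancel_iff)
    then have j: "real j \<le> - log 2 r" "- log 2 r < real j + 1"
      unfolding j_def by linarith+
    have r_eq: "r = 2 powr log 2 r"
      using r by simp
    have "r \<le> 2 powr - real j"
      using j by (subst r_eq, intro powr_mono) auto
    then have "cball x r \<subseteq> cball x (1 / 2 ^ j)"
      by (intro subset_cball) (simp add: powr_minus powr_realpow inverse_eq_divide)
    then have "measure law (cball x r) \<le> measure law (cball x (1 / 2 ^ j))"
      using real_distribution_law
      by (intro finite_measure.finite_measure_mono)
        (auto simp: real_distribution.finite_borel_measure_M[THEN finite_borel_measure.axioms(1)]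
          real_distribution.events_eq_borel)
    also have "\<dots> \<le> 5 / 2 ^ m j"
      by (rule law_cball_le)
    also have "\<dots> \<le> 5 / (2 powr (s * j) / 2)"
      by (intro divide_left_mono power_m) auto
    also have "\<dots> = 10 * 2 powr (- s * j)"
      by (simp add: powr_minus field_simps)
    also have "\<dots> \<le> 10 * 2 powr (s * (log 2 r + 1))"
    proof -
      have "s * - real j \<le> s * (log 2 r + 1)"
        using j s by (intro mult_left_mono) auto
      then show ?thesis by simp
    qed
    also have "\<dots> = 10 * (2 powr s * r powr s)"
      using r by (simp add: distrib_left powr_add powr_powr[symmetric] mult.commute[of s])
    also have "\<dots> \<le> 10 * (2 powr 1 * r powr s)"
      using s by (intro mult_left_mono mult_right_mono powr_mono) auto
    finally show ?thesis by simp
  qed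
  moreover have "\<exists>C. \<forall>t. t \<noteq> 0 \<longrightarrow> norm (char law t) \<le> C * \<bar>t\<bar> powr - a"
    if a: "0 \<le> a" "a < s / 2" for a
  proof -
    \<comment> \<open>\<open>q\<close> combines the loss \<open>2 powr a\<close> and the gain
      \<open>2 powr (s / 2)\<close> per level. In \<open>D\<close>, \<open>sqrt 2\<close> pays for
      the rounding in \<open>m\<close>, and \<open>4 powr a\<close> comes from
      \<open>2 / |t / 2 ^ Suc j|\<close>. The weights \<open>Suc j\<close> lead to the derivative of
      the geometric series.\<close>
    define q where "q = 2 powr (a - s / 2)"
    define D where "D = 13 * sqrt 2 * 4 powr a"
    have q: "0 < q" "q < 1"
      using a by (auto simp: q_def powr_less_one)
    have sums: "(\<lambda>j. D * (real (Suc j) * q ^ j)) sums (D * (1 / (1 - q)\<^sup>2))"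
      using geometric_deriv_sums[of q] q by (intro sums_mult) simp
    have "norm (char law t) \<le> (2 powr a + D * (1 / (1 - q)\<^sup>2)) * \<bar>t\<bar> powr - a" if t: "t \<noteq> 0" for t
    proof -
      define X where "X = (\<lambda>j. selection_char j (2 ^ m j) (k j) t)"
      have X0: "norm (X 0) \<le> 2 powr a * \<bar>t\<bar> powr - a"
      proof -
        have "k 0 0 = 0"
          using k(1)[of 0] unfolding dyadic_selection_def image_subset_iff by (simp add: m_0)
        then have "X 0 = unif_char t"
          by (simp add: X_def selection_char_def m_0)
        then have "norm (X 0) \<le> (2 / \<bar>t\<bar>) powr a"
          using norm_unif_char_le_powr[OF t, of a] a s by simp
        then show ?thesis
          by (simp add: powr_divide powr_minus_divide)
      qed
      have step: "norm (X (Suc j) - X j) \<le> D * (real (Suc j) * q ^ j) * \<bar>t\<bar> powr - a" for j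
      proof -
        have "1 / sqrt (2 ^ m j) \<le> 1 / sqrt (2 powr (s * j) / 2)"
          by (intro divide_left_mono real_sqrt_le_mono power_m) auto
        also have "\<dots> = sqrt 2 * 2 powr (- s / 2 * j)"
          by (simp add: real_sqrt_divide powr_half_sqrt[symmetric] powr_powr powr_minus field_simps)
        finally have root: "1 / sqrt (2 ^ m j) \<le> sqrt 2 * 2 powr (- s / 2 * j)" .
        have "norm (unif_char (t / 2 ^ Suc j)) \<le> (2 / \<bar>t / 2 ^ Suc j\<bar>) powr a"
          using t a s by (intro norm_unif_char_le_powr) auto
        also have "2 / \<bar>t / 2 ^ Suc j\<bar> = 4 * 2 powr real j / \<bar>t\<bar>"
          by (simp add: abs_divide powr_realpow)
        also have "\<dots> powr a = 4 powr a * 2 powr (a * j) * \<bar>t\<bar> powr - a"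
          by (simp add: powr_divide powr_mult powr_powr powr_minus_divide mult.commute)
        finally have phi: "norm (unif_char (t / 2 ^ Suc j)) \<le> 4 powr a * 2 powr (a * j) * \<bar>t\<bar> powr - a" .
        have "norm (X (Suc j) - X j) \<le>
            13 * real (j + 1) * (1 / sqrt (2 ^ m j)) * norm (unif_char (t / 2 ^ Suc j))"
          using diff[of j t] by (simp add: X_def)
        also have "\<dots> \<le> 13 * real (j + 1) * (sqrt 2 * 2 powr (- s / 2 * j)) *
            (4 powr a * 2 powr (a * j) * \<bar>t\<bar> powr - a)"
          by (intro mult_mono root phi) auto
        also have "\<dots> = D * (real (Suc j) * (2 powr (- s / 2 * j) * 2 powr (a * j))) * \<bar>t\<bar> powr - a"
          by (simp add: D_def)
        also have "2 powr (- s / 2 * j) * 2 powr (a * j) = q ^ j"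
          by (simp add: q_def powr_add[symmetric] powr_realpow[symmetric] powr_powr algebra_simps)
        finally show ?thesis .
      qed
      have "norm (char law t) \<le> norm (X 0) + (\<Sum>j. D * (real (Suc j) * q ^ j) * \<bar>t\<bar> powr - a)"
        using selection_char_tendsto[of t] sums_summable[OF sums] step unfolding X_def
        by (intro norm_limit_le_suminf summable_mult2) auto
      also have "(\<Sum>j. D * (real (Suc j) * q ^ j) * \<bar>t\<bar> powr - a) = D * (1 / (1 - q)\<^sup>2) * \<bar>t\<bar> powr - a"
        using sums_mult2[OF sums] by (rule sums_unique[symmetric])
      finally show ?thesis
        using X0 by (simp add: distrib_right)
    qed
    then show ?thesis by blast
  qed
  ultimately show ?thesis
    using real_distribution_law by (intro exI[of _ law]) blast
qed

section \<open>Supports, dyadic covers and Hausdorff dimension\<close>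

lemma closed_measure_support: "closed (measure_support M)"
proof -
  have "- measure_support M = \<Union>{U. open U \<and> emeasure M U = 0}"
    by (auto simp: measure_support_def not_gr_zero)
  then have "open (- measure_support M)"
    by (auto intro!: open_Union)
  then show ?thesis
    by (simp add: closed_def)
qed

text \<open>The complement of the support is a union of open null sets, and by Lindelof countably
  many of them suffice.\<close>

lemma AE_measure_support:
  fixes M :: "'a::second_countable_topology measure"
  assumes "sets M = sets borel"
  shows "AE x in M. x \<in> measure_support M"
proof -
  define F where "F = {U. open U \<and> emeasure M U = 0}"
  obtain F' where F': "F' \<subseteq> F" "countable F'" "\<Union>F' = \<Union>F"
    using Lindelof[of F] by (auto simp: F_def)
  have "\<Union>F = {x. x \<notin> measure_support M}"
    by (auto simp: F_def measure_support_def not_gr_zero)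
  moreover have "(\<Union>U\<in>F'. U) \<in> null_sets M"
    using F' assms by (intro null_sets_UN') (auto simp: F_def null_sets_def)
  ultimately show ?thesis
    using F'(3) by (intro AE_I'[of "\<Union>F'"]) auto
qed

lemma measure_support_subset_closed:
  assumes "sets M = sets borel" "closed F" "AE x in M. x \<in> F"
  shows "measure_support M \<subseteq> F"
proof -
  have "emeasure M (- F) = 0"
    using assms AE_iff_measurable[of "- F" M "\<lambda>x. x \<in> F"] sets_eq_imp_space_eq[OF assms(1)]
    by (auto simp: Compl_eq[symmetric])
  then show ?thesis
    using assms(2) by (fastforce simp: measure_support_def)
qed

section \<open>Closed sets as limits of dyadic intervals\<close>

definition dyadic_trace :: "real set \<Rightarrow> nat \<Rightarrow> real set" where
  "dyadic_trace E j = {a \<in> dyadic_grid j. {a..a + 1 / 2 ^ j} \<inter> E \<noteq> {}}"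

lemma dyadic_level_trace_Suc:
  "dyadic_level (dyadic_trace E) (Suc j) \<subseteq> dyadic_level (dyadic_trace E) j"
proof
  fix x assume "x \<in> dyadic_level (dyadic_trace E) (Suc j)"
  then obtain k :: nat and y where k: "k < 2 ^ Suc j" and y: "y \<in> E"
      "y \<in> {k / 2 ^ Suc j..k / 2 ^ Suc j + 1 / 2 ^ Suc j}"
    and x: "x \<in> {k / 2 ^ Suc j..k / 2 ^ Suc j + 1 / 2 ^ Suc j}"
    unfolding dyadic_level_def dyadic_trace_def dyadic_grid_def by blast
  \<comment> \<open>Interval \<open>k\<close> lies in its parent, number \<open>k div 2\<close>,
    which therefore meets \<open>E\<close> as well.\<close>
  have div: "2 * real (k div 2) \<le> k" "k + 1 \<le> 2 * real (k div 2) + 2"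
    by linarith+
  have sub: "{k / 2 ^ Suc j..k / 2 ^ Suc j + 1 / 2 ^ Suc j} \<subseteq>
      {real (k div 2) / 2 ^ j..real (k div 2) / 2 ^ j + 1 / 2 ^ j}"
  proof -
    have "2 * real (k div 2) / 2 ^ Suc j \<le> k / 2 ^ Suc j"
      "(k + 1) / 2 ^ Suc j \<le> (2 * real (k div 2) + 2) / 2 ^ Suc j"
      using div by (intro divide_right_mono; simp)+
    then show ?thesis
      by (auto simp: add_divide_distrib)
  qed
  have "k div 2 < 2 ^ j"
    using k by auto
  moreover have "y \<in> {real (k div 2) / 2 ^ j..real (k div 2) / 2 ^ j + 1 / 2 ^ j} \<inter> E"
    using sub y by blast
  ultimately have "real (k div 2) / 2 ^ j \<in> dyadic_trace E j"
    unfolding dyadic_trace_def dyadic_grid_def by blast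
  then show "x \<in> dyadic_level (dyadic_trace E) j"
    using sub x unfolding dyadic_level_def by blast
qed

lemma dyadic_interval_exists:
  assumes "0 \<le> x" "x \<le> 1"
  shows "\<exists>a\<in>dyadic_grid j. a \<le> x \<and> x \<le> a + 1 / 2 ^ j"
proof (cases "x = 1")
  case True
  \<comment> \<open>The grid omits 1, so the point 1 is covered as the right end of the last
    interval.\<close>
  define K :: nat where "K = 2 ^ j - 1"
  have K: "real K = 2 ^ j - 1" "K < 2 ^ j"
    by (simp_all add: K_def of_nat_diff)
  then have "x = real K / 2 ^ j + 1 / 2 ^ j"
    using True by (simp add: add_divide_distrib[symmetric])
  then show ?thesis
    using K(2) by (intro bexI[of _ "real K / 2 ^ j"]) (auto simp: dyadic_grid_def)
next
  case False
  define k where "k = nat \<lfloor>x * 2 ^ j\<rfloor>"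
  have "x * 2 ^ j < 2 ^ j" "0 \<le> x * 2 ^ j"
    using assms False by auto
  then have k: "real k \<le> x * 2 ^ j" "x * 2 ^ j \<le> real k + 1"
    unfolding k_def by linarith+
  have "real k < 2 ^ j"
    using k(1) \<open>x * 2 ^ j < 2 ^ j\<close> by (rule le_less_trans)
  then have "k < 2 ^ j"
    by simp
  then show ?thesis
    using k by (intro bexI[of _ "real k / 2 ^ j"]) (auto simp: dyadic_grid_def field_simps)
qed

lemma dyadic_limit_trace:
  assumes "closed E" "E \<subseteq> {0..1}"
  shows "dyadic_limit (dyadic_trace E) = E"
proof
  show "E \<subseteq> dyadic_limit (dyadic_trace E)"
  proof
    fix x assume x: "x \<in> E"
    have "x \<in> dyadic_level (dyadic_trace E) j" for j
    proof -
      obtain a where "a \<in> dyadic_grid j" "a \<le> x" "x \<le> a + 1 / 2 ^ j"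
        using dyadic_interval_exists[of x j] subsetD[OF assms(2) x] by auto
      then have "a \<in> dyadic_trace E j" "x \<in> {a..a + 1 / 2 ^ j}"
        using x by (auto simp: dyadic_trace_def disjoint_iff)
      then show ?thesis
        unfolding dyadic_level_def by blast
    qed
    then show "x \<in> dyadic_limit (dyadic_trace E)"
      by (simp add: dyadic_limit_def)
  qed
next
  show "dyadic_limit (dyadic_trace E) \<subseteq> E"
  proof
    fix x assume x: "x \<in> dyadic_limit (dyadic_trace E)"
    have "\<exists>y\<in>E. dist y x < e" if e_pos: "0 < e" for e
    proof -
      obtain j where j: "(1 / 2 :: real) ^ j < e"
        using real_arch_pow_inv[of e "1 / 2"] e_pos by auto
      moreover have "(1 / 2 :: real) ^ Suc j \<le> (1 / 2) ^ j"
        by (intro power_decreasing) auto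
      ultimately have "(1 / 2 :: real) ^ Suc j < e"
        by linarith
      then have e: "1 / 2 ^ Suc j < e"
        by (simp add: power_divide)
      have "x \<in> dyadic_level (dyadic_trace E) (Suc j)"
        using x by (auto simp: dyadic_limit_def)
      then obtain a y where "a \<le> x" "x \<le> a + 1 / 2 ^ Suc j" "y \<in> E" "a \<le> y" "y \<le> a + 1 / 2 ^ Suc j"
        by (auto simp: dyadic_level_def dyadic_trace_def)
      then show ?thesis
        using e by (intro bexI[of _ y]) (auto simp: dist_real_def simp del: power_Suc)
    qed
    then have "x \<in> closure E"
      by (simp add: closure_approachable)
    then show "x \<in> E"
      using assms(1) by simp
  qed
qed

section \<open>Hausdorff dimension from covers and from mass bounds\<close>

lemma hausdorff_measure_eq_0I:
  fixes E :: "real set" and N :: "nat \<Rightarrow> real"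
  assumes d: "0 < d"
    and cover: "\<And>m. \<exists>I. finite I \<and> card I \<le> N m \<and> E \<subseteq> (\<Union>i\<in>I. {real i / 2 ^ m..(real i + 1) / 2 ^ m})"
    and lim: "(\<lambda>m. N m * (1 / 2 ^ m) powr d) \<longlonglongrightarrow> 0"
  shows "hausdorff_measure d E = 0"
proof -
  have le_eps: "hausdorff_premeasure d \<delta> E \<le> 0 + ennreal \<eta>" if "0 < \<delta>" "0 < \<eta>" for \<delta> \<eta>
  proof -
    have "(\<lambda>m. (1 / 2 :: real) ^ m) \<longlonglongrightarrow> 0"
      by (intro LIMSEQ_power_zero) simp
    then have "\<forall>\<^sub>F m in sequentially. (1 / 2 :: real) ^ m < \<delta>"
      using that(1) by (rule order_tendstoD)
    moreover have "\<forall>\<^sub>F m in sequentially. N m * (1 / 2 ^ m) powr d < \<eta>"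
      using lim that(2) by (rule order_tendstoD)
    ultimately have "\<forall>\<^sub>F m in sequentially. (1 / 2 :: real) ^ m < \<delta> \<and> N m * (1 / 2 ^ m) powr d < \<eta>"
      by (rule eventually_conj)
    then obtain m where m: "1 / 2 ^ m < \<delta>" "N m * (1 / 2 ^ m) powr d < \<eta>"
      by (auto simp: eventually_sequentially power_divide)
    obtain I where I: "finite I" "card I \<le> N m"
        "E \<subseteq> (\<Union>i\<in>I. {real i / 2 ^ m..(real i + 1) / 2 ^ m})"
      using cover by blast
    obtain f where f: "bij_betw f {0..<card I} I"
      using ex_bij_betw_nat_finite[OF I(1)] by blast
    \<comment> \<open>The finite cover is continued by empty sets, which contribute 0.\<close>
    define U where "U = (\<lambda>n. if n < card I then {real (f n) / 2 ^ m..(real (f n) + 1) / 2 ^ m} else {})"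
    have le: "real i / 2 ^ m \<le> (real i + 1) / 2 ^ m" for i :: nat
      by (intro divide_right_mono) auto
    have diam: "diameter {real i / 2 ^ m..(real i + 1) / 2 ^ m} = 1 / 2 ^ m" for i :: nat
      using le[of i] by (subst diameter_closed_interval) (auto simp: diff_divide_distrib[symmetric])
    have "E \<subseteq> (\<Union>n. U n)"
    proof
      fix x assume "x \<in> E"
      then obtain i where "i \<in> I" "x \<in> {real i / 2 ^ m..(real i + 1) / 2 ^ m}"
        using I(3) by blast
      moreover then obtain n where "n < card I" "f n = i"
        using f unfolding bij_betw_def by force
      ultimately show "x \<in> (\<Union>n. U n)"
        by (auto simp: U_def)
    qed
    moreover have "bounded (U n) \<and> diameter (U n) \<le> \<delta>" for n
      using m(1) that(1) by (auto simp: U_def diam simp del: diameter_closed_interval)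
    ultimately have "hausdorff_premeasure d \<delta> E \<le> (\<Sum>n. diam_powr d (U n))"
      unfolding hausdorff_premeasure_def
      by (intro Inf_lower CollectI exI[of _ U] conjI refl) simp_all
    also have "\<dots> = (\<Sum>n<card I. diam_powr d (U n))"
      by (rule suminf_finite) (auto simp: U_def diam_powr_def)
    also have "\<dots> = (\<Sum>n<card I. ennreal ((1 / 2 ^ m) powr d))"
    proof (rule sum.cong)
      fix n assume "n \<in> {..<card I}"
      then have U: "U n = {real (f n) / 2 ^ m..(real (f n) + 1) / 2 ^ m}"
        by (simp add: U_def)
      then have "U n \<noteq> {}"
        using le[of "f n"] by simp
      then show "diam_powr d (U n) = ennreal ((1 / 2 ^ m) powr d)"
        unfolding diam_powr_def U diam using d by simp
    qed simp
    also have "\<dots> = ennreal (card I * (1 / 2 ^ m) powr d)"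
      by (simp add: ennreal_mult ennreal_of_nat_eq_real_of_nat)
    also have "\<dots> \<le> ennreal \<eta>"
    proof (rule ennreal_leI)
      have "card I * (1 / 2 ^ m) powr d \<le> N m * (1 / 2 ^ m) powr d"
        using I(2) by (rule mult_right_mono) simp
      then show "card I * (1 / 2 ^ m) powr d \<le> \<eta>"
        using m(2) by linarith
    qed
    finally show ?thesis by simp
  qed
  have "hausdorff_premeasure d \<delta> E \<le> 0" if "0 < \<delta>" for \<delta>
    by (rule ennreal_le_epsilon) (rule le_eps[OF that])
  then have "hausdorff_measure d E \<le> 0"
    unfolding hausdorff_measure_def by (intro SUP_least) simp
  then show ?thesis
    by simp
qed

lemma hausdorff_premeasure_lessD:
  assumes "hausdorff_premeasure d \<delta> E < c"
  shows "\<exists>U. E \<subseteq> (\<Union>n. U n) \<and> (\<forall>n. bounded (U n) \<and> diameter (U n) \<le> \<delta>) \<and>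
    (\<Sum>n. diam_powr d (U n)) < c"
  using assms unfolding hausdorff_premeasure_def Inf_less_iff by blast

text \<open>A set of diameter \<open>r\<close> lies in a closed ball of radius \<open>r\<close>,
  whose mass is at most a constant times \<open>r powr d\<close>. A cover with too small a sum would
  therefore give \<open>E\<close> mass below 1.\<close>

lemma mass_distribution_principle:
  fixes E :: "real set"
  assumes M: "real_distribution M" and E: "E \<in> sets borel" "AE x in M. x \<in> E"
    and ball: "\<And>x r. 0 < r \<Longrightarrow> r \<le> 1 \<Longrightarrow> measure M (cball x r) \<le> C * r powr s"
    and d: "0 \<le> d" "d < s"
  shows "hausdorff_measure d E \<noteq> 0"
proof
  interpret real_distribution M by fact
  assume zero: "hausdorff_measure d E = 0"
  have "hausdorff_premeasure d 1 E \<le> hausdorff_measure d E"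
    unfolding hausdorff_measure_def by (rule SUP_upper) simp
  then have premeasure: "hausdorff_premeasure d 1 E = 0"
    using zero by simp
  define D where "D = max 1 C"
  have D: "1 \<le> D" "C \<le> D"
    by (auto simp: D_def)
  \<comment> \<open>With the threshold \<open>1 / D\<close> the enclosing balls have total mass
    below 1. Scale 1 keeps their radii in the range of \<open>ball\<close>.\<close>
  have "hausdorff_premeasure d 1 E < ennreal (1 / D)"
    using D by (simp add: premeasure)
  then obtain U where U_cover: "E \<subseteq> (\<Union>n. U n)"
    and U_small: "\<forall>n. bounded (U n) \<and> diameter (U n) \<le> 1"
    and less: "(\<Sum>n. diam_powr d (U n)) < ennreal (1 / D)"
    using hausdorff_premeasure_lessD by metis
  have U: "bounded (U n)" "diameter (U n) \<le> 1" for n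
    using U_small by simp_all
  define c where "c = (\<lambda>n. SOME x. x \<in> U n)"
  \<comment> \<open>\<open>U n\<close> need not be measurable, so it is enclosed in a closed ball
    around one of its points.\<close>
  define V where "V = (\<lambda>n. if U n = {} then {} else cball (c n) (diameter (U n)))"
  have V_borel: "V n \<in> sets M" for n
    by (cases "U n = {}") (simp_all add: V_def borel_closed)
  have UV: "U n \<subseteq> V n" for n
  proof
    fix y assume y: "y \<in> U n"
    have "c n \<in> U n"
      unfolding c_def using y by (rule someI)
    then have "dist (c n) y \<le> diameter (U n)"
      using y by (intro diameter_bounded_bound U(1))
    then show "y \<in> V n"
      using y by (auto simp: V_def)
  qed
  have ball0: "measure M (cball x r) \<le> D * r powr d" if r: "0 < r" "r \<le> 1" for x r
  proof -
    have "measure M (cball x r) \<le> C * r powr s"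
      using r by (rule ball)
    also have "\<dots> \<le> D * r powr d"
      using D d r by (intro mult_mono powr_mono') auto
    finally show ?thesis .
  qed
  have V: "emeasure M (V n) \<le> ennreal D * diam_powr d (U n)" for n
  proof (cases "U n = {}")
    case False
    define r where "r = diameter (U n)"
    obtain x where x: "V n = cball x r"
      using False by (simp add: V_def r_def)
    have r: "0 \<le> r" "r \<le> 1"
      using U[of n] by (auto simp: r_def diameter_ge_0)
    \<comment> \<open>For \<open>d = 0\<close> a nonempty set counts 1, which bounds any mass. For
      \<open>d > 0\<close> a set of diameter 0 counts 0, so single points must have no mass; this
      follows by letting the radius tend to 0.\<close>
    consider "d = 0" | "d \<noteq> 0" "r = 0" | "d \<noteq> 0" "0 < r"
      using r by fastforce
    then show ?thesis
    proof cases
      case 1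
      have "emeasure M (V n) \<le> 1"
        by (rule emeasure_le_1)
      then show ?thesis
        using D False 1 by (simp add: diam_powr_def order_trans)
    next
      case 2
      have "measure M (cball x 0) \<le> 0"
      proof (rule tendsto_lowerbound)
        have "((\<lambda>r. D * r powr d) \<longlongrightarrow> D * 0) (at_right 0)"
          using d 2
          by (intro tendsto_mult tendsto_const tendsto_zero_powrI[where b = d])
            (auto simp: eventually_at_right_less intro: eventually_mono[OF eventually_at_right_less])
        then show "((\<lambda>r. D * r powr d) \<longlongrightarrow> 0) (at_right 0)" by simp
        have "measure M (cball x 0) \<le> D * r powr d" if "0 < r" "r \<le> 1" for r
          using ball0[OF that, of x] that
          by (intro order_trans[OF finite_measure_mono[of "cball x 0" "cball x r"]]) auto
        then show "\<forall>\<^sub>F r in at_right 0. measure M (cball x 0) \<le> D * r powr d"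
          by (auto simp: eventually_at_right[of 0 1] intro!: exI[of _ 1])
      qed simp
      then show ?thesis
        using x 2 by (simp add: emeasure_eq_measure measure_le_0_iff)
    next
      case 3
      then show ?thesis
        using ball0[of r x] r x False D
        by (simp add: emeasure_eq_measure diam_powr_def r_def[symmetric] ennreal_mult[symmetric])
    qed
  qed (simp add: V_def)
  have "1 = emeasure M E"
    using E by (subst emeasure_eq_1_AE) auto
  also have "\<dots> \<le> emeasure M (\<Union>n. V n)"
    using U_cover UV V_borel by (intro emeasure_mono) blast+
  also have "\<dots> \<le> (\<Sum>n. emeasure M (V n))"
    using V_borel by (intro emeasure_subadditive_countably) auto
  also have "\<dots> \<le> (\<Sum>n. ennreal D * diam_powr d (U n))"
    using V by (intro suminf_le) auto
  also have "\<dots> = ennreal D * (\<Sum>n. diam_powr d (U n))"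
    by simp
  also have "\<dots> < 1"
  proof -
    obtain S where S: "(\<Sum>n. diam_powr d (U n)) = ennreal S" "0 \<le> S"
      using less by (cases "\<Sum>n. diam_powr d (U n)" rule: ennreal_cases) auto
    then have "D * S < 1"
      using less D by (simp add: ennreal_less_iff field_simps)
    then show ?thesis
      using S D by (simp add: ennreal_mult[symmetric])
  qed
  finally show False by simp
qed

lemma hausdorff_dim_eqI:
  assumes "0 \<le> s" "\<And>d. s < d \<Longrightarrow> hausdorff_measure d E = 0"
    and "\<And>d. 0 \<le> d \<Longrightarrow> d < s \<Longrightarrow> hausdorff_measure d E \<noteq> 0"
  shows "hausdorff_dim E = ennreal s"
proof (rule antisym)
  show "hausdorff_dim E \<le> ennreal s"
  proof (rule ennreal_le_epsilon)
    fix e :: real assume "0 < e"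
    then have "hausdorff_dim E \<le> ennreal (s + e)"
      unfolding hausdorff_dim_def using assms(1,2) by (intro Inf_lower imageI) simp
    then show "hausdorff_dim E \<le> ennreal s + ennreal e"
      using assms(1) \<open>0 < e\<close> by simp
  qed
  show "ennreal s \<le> hausdorff_dim E"
    unfolding hausdorff_dim_def using assms(3) by (intro Inf_greatest) (force intro: ennreal_leI)
qed

section \<open>Mixtures of dyadic dilations\<close>

text \<open>The law of \<open>x / 2 ^ n\<close> for independent \<open>n\<close> and
  \<open>x\<close> with laws \<open>q\<close> and \<open>M\<close>, that is, the mixture of dilates
  with weights \<open>pmf q n\<close>.\<close>

definition dyadic_mixture :: "nat pmf \<Rightarrow> real measure \<Rightarrow> real measure" where
  "dyadic_mixture q M = distr (measure_pmf q \<Otimes>\<^sub>M M) borel (\<lambda>(n, x). x / 2 ^ n)"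

context real_distribution
begin

context
  fixes q :: "nat pmf"
begin

interpretation P: pair_prob_space "measure_pmf q" M ..

lemma measurable_dilation [measurable]:
  "(\<lambda>(n, x). x / 2 ^ n) \<in> borel_measurable (measure_pmf q \<Otimes>\<^sub>M M)"
  by measurable

lemma real_distribution_dyadic_mixture: "real_distribution (dyadic_mixture q M)"
  unfolding dyadic_mixture_def by (rule P.real_distribution_distr) measurable

lemma AE_dyadic_mixtureI:
  assumes [measurable]: "Measurable.pred borel Q" and "\<And>n. AE x in M. Q (x / 2 ^ n)"
  shows "AE x in dyadic_mixture q M. Q x"
proof -
  have "AE z in measure_pmf q \<Otimes>\<^sub>M M. Q (snd z / 2 ^ fst z)"
    using assms(2) by (intro P.AE_pair_measure) auto
  then show ?thesis
    unfolding dyadic_mixture_def by (subst AE_distr_iff) (auto simp: case_prod_beta)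
qed

text \<open>A dilate of positive weight has no mass on null sets of the mixture. The case
  \<open>n = 0\<close> shows that \<open>M\<close> lives on the support of the mixture.\<close>

lemma AE_dyadic_mixtureD:
  assumes [measurable]: "Measurable.pred borel Q" and "AE x in dyadic_mixture q M. Q x"
    and n: "n \<in> set_pmf q"
  shows "AE x in M. Q (x / 2 ^ n)"
proof -
  have "AE z in measure_pmf q \<Otimes>\<^sub>M M. Q (snd z / 2 ^ fst z)"
    using assms(2) unfolding dyadic_mixture_def
    by (subst (asm) AE_distr_iff) (auto simp: case_prod_beta)
  from P.AE_pair[OF this] show ?thesis
    using n by (auto simp: AE_measure_pmf_iff)
qed

lemma char_dyadic_mixture:
  "char (dyadic_mixture q M) t = (\<integral>n. char M (t / 2 ^ n) \<partial>measure_pmf q)"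
proof -
  have "char (dyadic_mixture q M) t = (\<integral>z. iexp (t * (snd z / 2 ^ fst z)) \<partial>(measure_pmf q \<Otimes>\<^sub>M M))"
    unfolding char_def dyadic_mixture_def by (subst integral_distr) (auto simp: case_prod_beta)
  also have "\<dots> = (\<integral>n. (\<integral>x. iexp (t * (snd (n, x) / 2 ^ fst (n, x))) \<partial>M) \<partial>measure_pmf q)"
  proof (rule P.integral_fst'[symmetric])
    show "integrable (measure_pmf q \<Otimes>\<^sub>M M) (\<lambda>z. iexp (t * (snd z / 2 ^ fst z)))"
      by (rule P.integrable_const_bound[where B = 1]) auto
  qed
  finally show ?thesis
    by (simp add: char_def)
qed

text \<open>All dilates from index \<open>N\<close> on live on \<open>[0, 1 / 2 ^ N]\<close>, which
  lies inside the ball.\<close>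

lemma measure_dyadic_mixture_ball_ge:
  assumes "AE x in M. 0 \<le> x \<and> x \<le> 1" and N: "1 / 2 ^ N < r"
  shows "measure (measure_pmf q) {N..} \<le> measure (dyadic_mixture q M) (ball 0 r)"
proof -
  have "measure (measure_pmf q) {N..} = P.prob ({N..} \<times> space M)"
    by (simp add: measure_def emeasure_pair_measure_Times emeasure_space_1[simplified])
  also have "\<dots> \<le> P.prob ((\<lambda>(n, x). x / 2 ^ n) -` ball 0 r \<inter> space (measure_pmf q \<Otimes>\<^sub>M M))"
  proof (rule P.finite_measure_mono_AE)
    have "AE z in measure_pmf q \<Otimes>\<^sub>M M. 0 \<le> snd z \<and> snd z \<le> 1"
      using assms(1) by (intro P.AE_pair_measure) auto
    then show "AE z in measure_pmf q \<Otimes>\<^sub>M M. z \<in> {N..} \<times> space M \<longrightarrow>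
        z \<in> (\<lambda>(n, x). x / 2 ^ n) -` ball 0 r \<inter> space (measure_pmf q \<Otimes>\<^sub>M M)"
    proof eventually_elim
      case (elim z)
      have "\<bar>snd z / 2 ^ fst z\<bar> < r" if "N \<le> fst z"
      proof -
        have "\<bar>snd z / 2 ^ fst z\<bar> \<le> 1 / 2 ^ fst z"
          using elim by (simp add: divide_right_mono)
        also have "\<dots> \<le> 1 / 2 ^ N"
          using that by (intro divide_left_mono power_increasing) auto
        finally show ?thesis
          using N by linarith
      qed
      then show ?case
        by (auto simp: space_pair_measure case_prod_beta)
    qed
  qed measurable
  also have "\<dots> = measure (dyadic_mixture q M) (ball 0 r)"
    unfolding dyadic_mixture_def by (subst measure_distr) auto
  finally show ?thesis .
qed

end

end

section \<open>Tails and exponential moments of geometric weights\<close>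

lemma measure_geometric_pmf_atLeast:
  assumes "0 < p" "p < 1"
  shows "measure (measure_pmf (geometric_pmf p)) {N..} = (1 - p) ^ N"
proof -
  have "measure (measure_pmf (geometric_pmf p)) {N..} = 1 - measure (measure_pmf (geometric_pmf p)) {..<N}"
    using measure_pmf.prob_compl[of "{..<N}" "geometric_pmf p"]
    by (simp add: Compl_eq_Diff_UNIV[symmetric])
  also have "measure (measure_pmf (geometric_pmf p)) {..<N} = p * (\<Sum>n<N. (1 - p) ^ n)"
    using assms by (simp add: measure_measure_pmf_finite sum_distrib_left mult.commute)
  also have "\<dots> = 1 - (1 - p) ^ N"
    using one_diff_power_eq[of "1 - p" N] by simp
  finally show ?thesis by simp
qed

lemma integrable_power_geometric_pmf:
  fixes b :: real
  assumes "0 < p" "p < 1" "0 \<le> b" "(1 - p) * b < 1"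
  shows "integrable (measure_pmf (geometric_pmf p)) (\<lambda>n. b ^ n)"
proof -
  have "summable (\<lambda>n. norm (((1 - p) * b) ^ n * p))"
    using assms by (simp add: abs_mult summable_mult2 summable_geometric flip: power_abs)
  then have "integrable (count_space UNIV) (\<lambda>n. pmf (geometric_pmf p) n *\<^sub>R b ^ n)"
    using assms by (subst integrable_count_space_nat_iff) (simp add: power_mult_distrib mult_ac)
  then show ?thesis
    unfolding measure_pmf_eq_density by (subst integrable_density) auto
qed

section \<open>Dimension, Fourier decay and mass near 0 of the geometric mixture\<close>

theorem theorem4p1:
  fixes s :: real
  assumes "0 < s" and "s \<le> 1"
  shows "\<exists>(A :: nat \<Rightarrow> real set) (\<mu> :: real measure).
     (\<forall>j\<ge>1. A j \<subseteq> dyadic_grid j) \<and>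
     (\<forall>j\<ge>1. dyadic_level A (Suc j) \<subseteq> dyadic_level A j) \<and>
     real_distribution \<mu> \<and>
     measure_support \<mu> = dyadic_limit A \<and>
     hausdorff_dim (measure_support \<mu>) = ennreal s \<and>
     hausdorff_dim (dyadic_limit A) = ennreal s \<and>
     (\<forall>\<epsilon>>0. \<exists>C::real. \<forall>\<xi>::real. \<bar>\<xi>\<bar> \<ge> 1 \<longrightarrow>
        norm (fourier_measure \<mu> \<xi>) \<le> C * \<bar>\<xi>\<bar> powr (- s / 2 + \<epsilon>)) \<and>
     (\<exists>x0\<in>measure_support \<mu>. \<exists>c>0. \<forall>r::real. 0 < r \<and> r \<le> 1 \<longrightarrow>
        measure \<mu> (ball x0 r) \<ge> c * r powr (s / 2))"
proof -
  obtain \<nu> C where \<nu>: "real_distribution \<nu>"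
    and cover: "\<forall>j. \<exists>K\<subseteq>{..<2 ^ j}. card K \<le> 2 powr (s * j) \<and>
      (AE x in \<nu>. \<exists>i\<in>K. real i / 2 ^ j \<le> x \<and> x \<le> (real i + 1) / 2 ^ j)"
    and frostman: "\<forall>x r. 0 < r \<and> r \<le> 1 \<longrightarrow> measure \<nu> (cball x r) \<le> C * r powr s"
    and decay: "\<forall>a. 0 \<le> a \<and> a < s / 2 \<longrightarrow>
      (\<exists>C. \<forall>t. t \<noteq> 0 \<longrightarrow> norm (char \<nu> t) \<le> C * \<bar>t\<bar> powr - a)"
    using exists_salem_measure[OF assms] by (elim exE conjE) (rule that)
  have ball: "\<And>x r. 0 < r \<Longrightarrow> r \<le> 1 \<Longrightarrow> measure \<nu> (cball x r) \<le> C * r powr s"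
    using frostman by blast
  have "\<exists>K. \<forall>j. K j \<subseteq> {..<2 ^ j} \<and> card (K j) \<le> 2 powr (s * j) \<and>
      (AE x in \<nu>. \<exists>i\<in>K j. real i / 2 ^ j \<le> x \<and> x \<le> (real i + 1) / 2 ^ j)"
    using cover by (rule choice)
  then obtain K where K_all: "\<forall>j. K j \<subseteq> {..<2 ^ j} \<and> card (K j) \<le> 2 powr (s * j) \<and>
      (AE x in \<nu>. \<exists>i\<in>K j. real i / 2 ^ j \<le> x \<and> x \<le> (real i + 1) / 2 ^ j)"
    by (elim exE) (rule that)
  have K: "K j \<subseteq> {..<2 ^ j}" "card (K j) \<le> 2 powr (s * j)"
    and \<nu>_K: "AE x in \<nu>. \<exists>i\<in>K j. real i / 2 ^ j \<le> x \<and> x \<le> (real i + 1) / 2 ^ j" for j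
    using spec[OF K_all, of j] by simp_all
  interpret \<nu>: real_distribution \<nu> by fact
  \<comment> \<open>The geometric weights then have tail
    \<open>(1 - p) ^ N = 2 powr (- s * N / 2)\<close>, the mass wanted at scale
    \<open>1 / 2 ^ N\<close>.\<close>
  define p where "p = 1 - 2 powr (- s / 2)"
  have p: "0 < p" "p < 1" "1 - p = 2 powr (- s / 2)"
    using assms by (auto simp: p_def powr_less_one)
  define \<mu> where "\<mu> = dyadic_mixture (geometric_pmf p) \<nu>"
  interpret \<mu>: real_distribution \<mu>
    unfolding \<mu>_def by (rule \<nu>.real_distribution_dyadic_mixture)
  define E where "E = measure_support \<mu>"
  have "closed E"
    unfolding E_def by (rule closed_measure_support)
  have unit: "AE x in \<nu>. 0 \<le> x \<and> x \<le> 1"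
    using \<nu>_K[of 0]
  proof eventually_elim
    case (elim x)
    then obtain i where "i \<in> K 0" "real i \<le> x" "x \<le> real i + 1"
      by auto
    moreover have "i = 0" if "i \<in> K 0" for i
      using that K(1)[of 0] by auto
    ultimately show ?case
      by fastforce
  qed
  have finite_K: "finite (K j)" for j
    using K(1)[of j] finite_subset by blast
  \<comment> \<open>At level \<open>m\<close> the dilate by \<open>1 / 2 ^ n\<close> looks like
    \<open>\<nu>\<close> at level \<open>m - n\<close>, with the same interval numbers. All dilates
    with \<open>n >= m\<close> fit into interval 0.\<close>
  define I where "I = (\<lambda>m. insert 0 (\<Union>n<m. K (m - n)))"
  have E_cover: "E \<subseteq> (\<Union>i\<in>I m. {real i / 2 ^ m..(real i + 1) / 2 ^ m})" for m
    unfolding E_def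
  proof (rule measure_support_subset_closed)
    show "closed (\<Union>i\<in>I m. {real i / 2 ^ m..(real i + 1) / 2 ^ m})"
      using finite_K by (intro closed_UN) (auto simp: I_def)
    have "AE x in \<nu>. \<exists>i\<in>I m. real i / 2 ^ m \<le> x / 2 ^ n \<and> x / 2 ^ n \<le> (real i + 1) / 2 ^ m" for n
    proof (cases "n < m")
      case True
      show ?thesis
        using \<nu>_K[of "m - n"]
      proof eventually_elim
        case (elim x)
        then obtain i where i: "i \<in> K (m - n)" "real i / 2 ^ (m - n) \<le> x" "x \<le> (real i + 1) / 2 ^ (m - n)"
          by blast
        have "(2::real) ^ m = 2 ^ (m - n) * 2 ^ n"
          using True by (simp flip: power_add)
        then have "real i / 2 ^ m \<le> x / 2 ^ n" "x / 2 ^ n \<le> (real i + 1) / 2 ^ m"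
          using i(2,3)[THEN divide_right_mono, of "2 ^ n"] by simp_all
        moreover have "i \<in> I m"
          using i(1) True by (auto simp: I_def)
        ultimately show ?case
          by blast
      qed
    next
      case False
      show ?thesis
        using unit
      proof eventually_elim
        case (elim x)
        have "x / 2 ^ n \<le> 1 / 2 ^ m"
          using elim False by (intro frac_le power_increasing) auto
        then show ?case
          using elim by (intro bexI[of _ 0]) (auto simp: I_def)
      qed
    qed
    then show "AE x in \<mu>. x \<in> (\<Union>i\<in>I m. {real i / 2 ^ m..(real i + 1) / 2 ^ m})"
      unfolding \<mu>_def using finite_K
      by (intro \<nu>.AE_dyadic_mixtureI) (auto simp: I_def)
  qed simp
  have "E \<subseteq> {0..1}"
    using E_cover[of 0] by (auto simp: I_def)
  have "hausdorff_measure d E = 0" if d: "s < d" for d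
  proof (rule hausdorff_measure_eq_0I)
    show "0 < d" using assms d by simp
    \<comment> \<open>Only \<open>m\<close> dilates are resolved at level \<open>m\<close>. The
      resulting factor \<open>m\<close> is harmless against the decay of
      \<open>2 powr ((s - d) * m)\<close>.\<close>
    have card_I: "card (I m) \<le> 1 + m * 2 powr (s * m)" for m
    proof -
      have "card (I m) \<le> 1 + (\<Sum>n<m. card (K (m - n)))"
        unfolding I_def by (intro order_trans[OF card_insert_le_m1])
          (auto intro!: card_UN_le)
      then have "real (card (I m)) \<le> 1 + (\<Sum>n<m. real (card (K (m - n))))"
        using of_nat_mono[where 'a = real] by fastforce
      also have "(\<Sum>n<m. real (card (K (m - n)))) \<le> (\<Sum>n<m. 2 powr (s * m))"
        using assms by (intro sum_mono order_trans[OF K(2)] powr_mono) auto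
      finally show ?thesis by simp
    qed
    then show "\<exists>J. finite J \<and> card J \<le> 1 + m * 2 powr (s * m) \<and>
        E \<subseteq> (\<Union>i\<in>J. {real i / 2 ^ m..(real i + 1) / 2 ^ m})" for m
      using E_cover[of m] finite_K by (intro exI[of _ "I m"]) (auto simp: I_def)
    have "(\<lambda>m. (2 powr - d) ^ m + m * (2 powr (s - d)) ^ m) \<longlonglongrightarrow> 0 + 0"
      using assms d by (intro tendsto_add LIMSEQ_power_zero powser_times_n_limit_0) (auto simp: powr_less_one)
    moreover have "(2 powr - d) ^ m + m * (2 powr (s - d)) ^ m =
        (1 + m * 2 powr (s * m)) * (1 / 2 ^ m) powr d" for m :: nat
      by (simp add: powr_realpow[symmetric] powr_powr powr_divide powr_minus_divide powr_diff
          left_diff_distrib field_simps)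
    ultimately show "(\<lambda>m. (1 + m * 2 powr (s * m)) * (1 / 2 ^ m) powr d) \<longlonglongrightarrow> 0"
      by simp
  qed
  \<comment> \<open>The lower bound uses \<open>\<nu>\<close>, since \<open>\<mu>\<close> puts mass
    of order at least \<open>r powr (s / 2)\<close> near 0 and violates the ball condition of order
    \<open>s\<close>.\<close>
  moreover have "hausdorff_measure d E \<noteq> 0" if "0 \<le> d" "d < s" for d
  proof (rule mass_distribution_principle[OF \<nu> _ _ ball that])
    show E_borel: "E \<in> sets borel"
      using \<open>closed E\<close> by (rule borel_closed)
    have "AE x in \<mu>. x \<in> E"
      unfolding E_def by (rule AE_measure_support) simp
    then have "AE x in \<nu>. x / 2 ^ 0 \<in> E"
      unfolding \<mu>_def using E_borel p
      by (intro \<nu>.AE_dyadic_mixtureD) (auto simp: set_pmf_geometric pred_def)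
    then show "AE x in \<nu>. x \<in> E"
      by simp
  qed
  ultimately have dim: "hausdorff_dim E = ennreal s"
    using assms by (intro hausdorff_dim_eqI) auto
  have fourier: "\<exists>C. \<forall>\<xi>. \<bar>\<xi>\<bar> \<ge> 1 \<longrightarrow> norm (fourier_measure \<mu> \<xi>) \<le> C * \<bar>\<xi>\<bar> powr (- s / 2 + \<epsilon>)"
    if \<epsilon>: "0 < \<epsilon>" for \<epsilon>
  proof -
    \<comment> \<open>The maximum keeps the exponent nonnegative when \<open>\<epsilon>\<close>
      exceeds \<open>s / 2\<close>.\<close>
    define a where "a = max 0 (s / 2 - \<epsilon>)"
    have a: "0 \<le> a" "a < s / 2" "- a \<le> - s / 2 + \<epsilon>"
      using \<epsilon> assms by (auto simp: a_def max_def)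
    obtain D where D: "\<And>t. t \<noteq> 0 \<Longrightarrow> norm (char \<nu> t) \<le> D * \<bar>t\<bar> powr - a"
      using decay a(1,2) by blast
    have "0 \<le> D"
      using order_trans[OF norm_ge_zero D[of 1]] by simp
    \<comment> \<open>Dilation by \<open>1 / 2 ^ n\<close> multiplies the Fourier bound by
      \<open>b ^ n\<close>. The weights absorb this because \<open>(1 - p) * b < 1\<close>.\<close>
    define b where "b = 2 powr a"
    have "(1 - p) * b = 2 powr (a - s / 2)"
      by (simp add: p(3) b_def powr_add[symmetric])
    then have int: "integrable (measure_pmf (geometric_pmf p)) (\<lambda>n. b ^ n)"
      using a p(1,2) by (intro integrable_power_geometric_pmf) (auto simp: b_def powr_less_one)
    define J where "J = (\<integral>n. b ^ n \<partial>measure_pmf (geometric_pmf p))"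
    have "0 \<le> J"
      unfolding J_def by (intro Bochner_Integration.integral_nonneg) (simp add: b_def)
    have "norm (fourier_measure \<mu> \<xi>) \<le> D * J * \<bar>\<xi>\<bar> powr (- s / 2 + \<epsilon>)" if \<xi>: "1 \<le> \<bar>\<xi>\<bar>" for \<xi>
    proof -
      define t where "t = - (2 * pi * \<xi>)"
      have "1 * \<bar>\<xi>\<bar> \<le> (2 * pi) * \<bar>\<xi>\<bar>"
        using pi_gt3 by (intro mult_right_mono) auto
      then have t: "\<bar>\<xi>\<bar> \<le> \<bar>t\<bar>"
        by (simp add: t_def abs_mult)
      have t0: "t \<noteq> 0"
        using t \<xi> by auto
      have "norm (char \<mu> t) \<le> (\<integral>n. D * \<bar>t\<bar> powr - a * b ^ n \<partial>measure_pmf (geometric_pmf p))"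
        unfolding \<mu>_def \<nu>.char_dyadic_mixture
      proof (rule order_trans[OF integral_norm_bound], rule integral_mono)
        show "integrable (measure_pmf (geometric_pmf p)) (\<lambda>n. norm (char \<nu> (t / 2 ^ n)))"
          by (rule measure_pmf.integrable_const_bound[where B = 1]) (auto simp: \<nu>.cmod_char_le_1)
        show "integrable (measure_pmf (geometric_pmf p)) (\<lambda>n. D * \<bar>t\<bar> powr - a * b ^ n)"
          using int by (rule integrable_mult_right)
        show "norm (char \<nu> (t / 2 ^ n)) \<le> D * \<bar>t\<bar> powr - a * b ^ n" for n
        proof -
          have "norm (char \<nu> (t / 2 ^ n)) \<le> D * \<bar>t / 2 ^ n\<bar> powr - a"
            using t0 by (intro D) simp
          also have "\<bar>t / 2 ^ n\<bar> powr - a = \<bar>t\<bar> powr - a * b ^ n"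
            by (simp add: abs_divide powr_divide powr_minus_divide b_def powr_realpow[symmetric]
                powr_powr mult.commute)
          finally show ?thesis by (simp add: mult_ac)
        qed
      qed
      also have "\<dots> = D * J * \<bar>t\<bar> powr - a"
        by (simp add: J_def mult_ac)
      also have "\<dots> \<le> D * J * \<bar>\<xi>\<bar> powr (- s / 2 + \<epsilon>)"
      proof (rule mult_left_mono)
        have "\<bar>t\<bar> powr - a \<le> \<bar>\<xi>\<bar> powr - a"
          using t \<xi> a by (intro powr_mono2') auto
        also have "\<dots> \<le> \<bar>\<xi>\<bar> powr (- s / 2 + \<epsilon>)"
          using a \<xi> by (intro powr_mono) auto
        finally show "\<bar>t\<bar> powr - a \<le> \<bar>\<xi>\<bar> powr (- s / 2 + \<epsilon>)" .
      qed (use \<open>0 \<le> D\<close> \<open>0 \<le> J\<close> in simp)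
      finally show ?thesis
        by (simp add: fourier_measure_def t_def)
    qed
    then show ?thesis by blast
  qed
  have mass: "2 powr (- s / 2) * r powr (s / 2) \<le> measure \<mu> (ball 0 r)" if r: "0 < r" "r \<le> 1" for r
  proof -
    \<comment> \<open>The least \<open>N\<close> with \<open>1 / 2 ^ N < r\<close>; the successor
      makes the inequality strict also when \<open>r\<close> is a power of 1/2. The factor
      \<open>2 powr (- s / 2)\<close> pays for \<open>N <= 1 - log 2 r\<close>.\<close>
    define N where "N = Suc (nat \<lfloor>- log 2 r\<rfloor>)"
    have "0 \<le> - log 2 r"
      using r by (simp add: log_le_zero_cancel_iff)
    then have N: "- log 2 r < real N" "real N \<le> 1 - log 2 r"
      unfolding N_def by linarith+
    have r_eq: "r = 2 powr log 2 r"
      using r by simp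
    have "2 powr - real N < r"
      using N by (subst r_eq, intro powr_less_mono) auto
    then have "1 / 2 ^ N < r"
      by (simp add: powr_minus powr_realpow inverse_eq_divide)
    then have "(1 - p) ^ N \<le> measure \<mu> (ball 0 r)"
      using \<nu>.measure_dyadic_mixture_ball_ge[OF unit, of N r "geometric_pmf p"]
        measure_geometric_pmf_atLeast[OF p(1,2), of N] by (simp add: \<mu>_def)
    moreover have "2 powr (- s / 2) * r powr (s / 2) \<le> (1 - p) ^ N"
    proof -
      have "2 powr (- s / 2) * r powr (s / 2) = 2 powr (- s / 2) * 2 powr (log 2 r * (s / 2))"
        unfolding powr_powr[symmetric] using r by simp
      also have "\<dots> = 2 powr (- s / 2 * (1 - log 2 r))"
        by (simp add: powr_add[symmetric] algebra_simps)
      also have "\<dots> \<le> 2 powr (- s / 2 * N)"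
        using N assms by (intro powr_mono mult_left_mono_neg) auto
      also have "\<dots> = (1 - p) ^ N"
        by (simp add: p(3) powr_realpow[symmetric] powr_powr)
      finally show ?thesis .
    qed
    ultimately show ?thesis by linarith
  qed
  have "0 \<in> E"
    unfolding E_def measure_support_def
  proof (intro CollectI allI impI)
    fix U :: "real set" assume U: "open U" "0 \<in> U"
    then obtain e where e: "0 < e" "ball 0 e \<subseteq> U"
      using open_contains_ball by blast
    define r where "r = min 1 e"
    have r: "0 < r" "r \<le> 1" "ball 0 r \<subseteq> U"
      using e by (auto simp: r_def)
    have "0 < measure \<mu> (ball 0 r)"
      using r(1) by (intro less_le_trans[OF _ mass[OF r(1,2)]]) simp
    also have "\<dots> \<le> measure \<mu> U"
      using r(3) U(1) by (intro \<mu>.finite_measure_mono) auto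
    finally show "0 < emeasure \<mu> U"
      by (simp add: \<mu>.emeasure_eq_measure)
  qed
  have limit: "dyadic_limit (dyadic_trace E) = E"
    using \<open>closed E\<close> \<open>E \<subseteq> {0..1}\<close> by (rule dyadic_limit_trace)
  show ?thesis
  proof (intro exI[of _ "dyadic_trace E"] exI[of _ \<mu>] conjI)
    show "\<exists>x0\<in>measure_support \<mu>. \<exists>c>0. \<forall>r. 0 < r \<and> r \<le> 1 \<longrightarrow>
        c * r powr (s / 2) \<le> measure \<mu> (ball x0 r)"
      using \<open>0 \<in> E\<close> mass unfolding E_def
      by (intro bexI[of _ 0] exI[of _ "2 powr (- s / 2)"]) auto
    show "\<forall>\<epsilon>>0. \<exists>C. \<forall>\<xi>. 1 \<le> \<bar>\<xi>\<bar> \<longrightarrow>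
        norm (fourier_measure \<mu> \<xi>) \<le> C * \<bar>\<xi>\<bar> powr (- s / 2 + \<epsilon>)"
      using fourier by blast
  qed (use dyadic_level_trace_Suc dim in \<open>auto simp: limit E_def[symmetric] dyadic_trace_def
      intro: \<mu>.real_distribution_axioms\<close>)
qed

end
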